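(* Let WSP with nested class-independent constraints in $r$ levels be the following decision problem. The input is a workflow $W=(S,U,\mathcal{A},C)$ with $k=|S|$ steps and $n=|U|\ge k$ users, together with equivalence relations $\sim_1,\dots,\sim_r$ on $U$ such that $\sim_{q+1}$ is a refinement of $\sim_q$ for each $q\in\{1,\dots,r-1\}$ and $\sim_r$ is the equality relation $=$, where $C=C_{\sim_1}\cup\dots\cup C_{\sim_r}$ and every constraint in $C_{\sim_q}$ is class-independent for $\sim_q$, for each $q\in\{1,\dots,r\}$ (the authorization lists $\mathcal{A}$ are arbitrary). The question is whether $W$ has a valid plan. Assume that all constraints can be checked in time polynomial in $n$. Then this problem is fixed-parameter tractable, with a running time of $O^*(2^{k\log((r+1)k)})$.
   Context: A workflow is $W=(S,U,\mathcal{A},C)$, where $S=\{s_1,\dots,s_k\}$ is a set of steps, $U=\{u_1,\dots,u_n\}$ is a set of users, $k\le n$, $\mathcal{A}=\{A(u):u\in U\}$ with $A(u)\subseteq S$ (the authorization list of $u$), and $C$ is a set of constraints. A constraint is a pair $c=(T,\Theta)$ with scope $T\subseteq S$ and $\Theta$ a set of functions $T\to U$ (given implicitly, not by enumeration). It is a standing assumption that whether a plan satisfies a constraint can be checked in time polynomial in $n$. A plan is a function $\pi:S\to U$. It is authorized if $s\in A(\pi(s))$ for all $s\in S$; it is eligible if $\pi|_T\in\Theta$ for all $(T,\Theta)\in C$; it is valid if it is both authorized and eligible. An equivalence relation $\sim$ is a refinement of an equivalence relation $\approx$ if $x\sim y$ implies $x\approx y$. For an equivalence relation $\sim$ on $U$,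 $U^{\sim}$ is the set of equivalence classes and $u^{\sim}$ is the class of $u$. For a function $\theta$ with values in $U$, $\theta^{\sim}(s)=(\theta(s))^{\sim}$, and $\Theta^{\sim}=\{\theta^{\sim}:\theta\in\Theta\}$. A constraint $(T,\Theta)$ is class-independent (CI) for $\sim$ if (1) for every $\theta:T\to U$, $\theta^{\sim}\in\Theta^{\sim}$ implies $\theta\in\Theta$, and (2) for every permutation $\phi:U^{\sim}\to U^{\sim}$, $\theta^{\sim}\in\Theta^{\sim}$ implies $\phi\circ\theta^{\sim}\in\Theta^{\sim}$. Fixed-parameter tractability is with respect to the parameters $k$ and $r$ jointly. $O^*(\cdot)$ suppresses factors polynomial in the input size. Logarithms are base 2. *)

theory Defs
  imports Complex_Main "HOL-Library.FuncSet" "HOL-Computational_Algebra.Polynomial"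
begin

text \<open>Functions with domain \<open>T\<close> are extensional functions (members of \<open>T \<rightarrow>\<^sub>E U\<close>).\<close>

type_synonym ('s, 'u) wconstraint = "'s set \<times> ('s \<Rightarrow> 'u) set"

record ('s, 'u) workflow =
  steps :: "'s set"
  users :: "'u set"
  auth :: "'u \<Rightarrow> 's set"
  constraints :: "('s, 'u) wconstraint set"

definition wf_constraint :: "'s set \<Rightarrow> 'u set \<Rightarrow> ('s, 'u) wconstraint \<Rightarrow> bool" where
  "wf_constraint S U = (\<lambda>(T, \<Theta>). T \<subseteq> S \<and> \<Theta> \<subseteq> T \<rightarrow>\<^sub>E U)"

definition wf_workflow :: "('s, 'u) workflow \<Rightarrow> bool" where
  "wf_workflow W \<longleftrightarrow>
     finite (steps W) \<and> finite (users W) \<and> card (steps W) \<le> card (users W) \<and>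
     (\<forall>u\<in>users W. auth W u \<subseteq> steps W) \<and>
     (\<forall>c\<in>constraints W. wf_constraint (steps W) (users W) c)"

definition plans :: "('s, 'u) workflow \<Rightarrow> ('s \<Rightarrow> 'u) set" where
  "plans W = steps W \<rightarrow>\<^sub>E users W"

definition authorized :: "('s, 'u) workflow \<Rightarrow> ('s \<Rightarrow> 'u) \<Rightarrow> bool" where
  "authorized W \<pi> \<longleftrightarrow> (\<forall>s\<in>steps W. s \<in> auth W (\<pi> s))"

definition satisfies :: "('s \<Rightarrow> 'u) \<Rightarrow> ('s, 'u) wconstraint \<Rightarrow> bool" where
  "satisfies \<pi> = (\<lambda>(T, \<Theta>). restrict \<pi> T \<in> \<Theta>)"

definition eligible :: "('s, 'u) workflow \<Rightarrow> ('s \<Rightarrow> 'u) \<Rightarrow> bool" where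
  "eligible W \<pi> \<longleftrightarrow> (\<forall>c\<in>constraints W. satisfies \<pi> c)"

definition valid_plan :: "('s, 'u) workflow \<Rightarrow> ('s \<Rightarrow> 'u) \<Rightarrow> bool" where
  "valid_plan W \<pi> \<longleftrightarrow> \<pi> \<in> plans W \<and> authorized W \<pi> \<and> eligible W \<pi>"

definition refinement :: "('u \<times> 'u) set \<Rightarrow> ('u \<times> 'u) set \<Rightarrow> bool" where
  "refinement R R' \<longleftrightarrow> (\<forall>x y. (x, y) \<in> R \<longrightarrow> (x, y) \<in> R')"

text \<open>\<open>class_map R T \<theta>\<close> is the map sending each step of \<open>T\<close> to the class of the
  user assigned to it, as an extensional function into \<open>U // R\<close>.\<close>

definition class_map :: "('u \<times> 'u) set \<Rightarrow> 's set \<Rightarrow> ('s \<Rightarrow> 'u) \<Rightarrow> 's \<Rightarrow> 'u set" where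
  "class_map R T \<theta> = (\<lambda>s\<in>T. R `` {\<theta> s})"

definition class_independent ::
  "'u set \<Rightarrow> ('u \<times> 'u) set \<Rightarrow> ('s, 'u) wconstraint \<Rightarrow> bool" where
  "class_independent U R = (\<lambda>(T, \<Theta>).
     (\<forall>\<theta> \<in> T \<rightarrow>\<^sub>E U. class_map R T \<theta> \<in> class_map R T ` \<Theta> \<longrightarrow> \<theta> \<in> \<Theta>) \<and>
     (\<forall>\<phi>. bij_betw \<phi> (U // R) (U // R) \<longrightarrow>
        (\<forall>\<theta> \<in> T \<rightarrow>\<^sub>E U. class_map R T \<theta> \<in> class_map R T ` \<Theta> \<longrightarrow>
           compose T \<phi> (class_map R T \<theta>) \<in> class_map R T ` \<Theta>)))"

text \<open>The WHILE language over binary trees of N. D. Jones (Computability and Complexity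
  from a Programming Perspective), with unit-cost time.  It simulates and is
  simulated by Turing machines with polynomial overhead; equality of trees is not
  primitive and trees may be shared, so each step adds only constantly many nodes to
  the store.  A program reads its input from and leaves its output in variable 0; all
  other variables are initially nil.\<close>

datatype val = Atom | Pair val val

fun vhd :: "val \<Rightarrow> val" where
  "vhd Atom = Atom"
| "vhd (Pair a b) = a"

fun vtl :: "val \<Rightarrow> val" where
  "vtl Atom = Atom"
| "vtl (Pair a b) = b"

datatype exp = EVar nat | ENil | ECons exp exp | EHd exp | ETl exp

type_synonym state = "nat \<Rightarrow> val"

fun eval_exp :: "exp \<Rightarrow> state \<Rightarrow> val" where
  "eval_exp (EVar x) s = s x"
| "eval_exp ENil s = Atom"
| "eval_exp (ECons e f) s = Pair (eval_exp e s) (eval_exp f s)"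
| "eval_exp (EHd e) s = vhd (eval_exp e s)"
| "eval_exp (ETl e) s = vtl (eval_exp e s)"

fun exp_cost :: "exp \<Rightarrow> nat" where
  "exp_cost (EVar x) = 1"
| "exp_cost ENil = 1"
| "exp_cost (ECons e f) = exp_cost e + exp_cost f + 1"
| "exp_cost (EHd e) = exp_cost e + 1"
| "exp_cost (ETl e) = exp_cost e + 1"

datatype com = Skip | Assign nat exp | Seq com com | Cond exp com com | While exp com

text \<open>\<open>exec c s m t\<close>: from state \<open>s\<close>, command \<open>c\<close> halts in state \<open>t\<close> after time \<open>m\<close>.\<close>

inductive exec :: "com \<Rightarrow> state \<Rightarrow> nat \<Rightarrow> state \<Rightarrow> bool" where
  Skip: "exec Skip s 1 s"
| Assign: "exec (Assign x e) s (exp_cost e + 1) (s(x := eval_exp e s))"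
| Seq: "exec c s m s' \<Longrightarrow> exec d s' m' s'' \<Longrightarrow> exec (Seq c d) s (m + m') s''"
| CondTrue: "eval_exp e s \<noteq> Atom \<Longrightarrow> exec c s m s' \<Longrightarrow>
    exec (Cond e c d) s (exp_cost e + 1 + m) s'"
| CondFalse: "eval_exp e s = Atom \<Longrightarrow> exec d s m s' \<Longrightarrow>
    exec (Cond e c d) s (exp_cost e + 1 + m) s'"
| WhileFalse: "eval_exp e s = Atom \<Longrightarrow> exec (While e c) s (exp_cost e + 1) s"
| WhileTrue: "eval_exp e s \<noteq> Atom \<Longrightarrow> exec c s m s' \<Longrightarrow> exec (While e c) s' m' s'' \<Longrightarrow>
    exec (While e c) s (exp_cost e + 1 + m + m') s''"

definition runs :: "com \<Rightarrow> val \<Rightarrow> val \<Rightarrow> nat \<Rightarrow> bool" where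
  "runs c a b m \<longleftrightarrow> (\<exists>t. exec c ((\<lambda>_. Atom)(0 := a)) m t \<and> t 0 = b)"

fun enc_bool :: "bool \<Rightarrow> val" where
  "enc_bool False = Atom"
| "enc_bool True = Pair Atom Atom"

fun enc_nat :: "nat \<Rightarrow> val" where
  "enc_nat 0 = Atom"
| "enc_nat (Suc n) = Pair Atom (enc_nat n)"

fun enc_list :: "('a \<Rightarrow> val) \<Rightarrow> 'a list \<Rightarrow> val" where
  "enc_list f [] = Atom"
| "enc_list f (x # xs) = Pair (f x) (enc_list f xs)"

definition enc_set :: "nat \<Rightarrow> nat set \<Rightarrow> val" where
  "enc_set m X = enc_list (\<lambda>i. enc_bool (i \<in> X)) [0..<m]"

definition enc_rel :: "nat \<Rightarrow> (nat \<times> nat) set \<Rightarrow> val" where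
  "enc_rel n R = enc_list (\<lambda>u. enc_set n (R `` {u})) [0..<n]"

definition enc_plan :: "nat \<Rightarrow> (nat \<Rightarrow> nat) \<Rightarrow> val" where
  "enc_plan k \<pi> = enc_list (\<lambda>s. enc_nat (\<pi> s)) [0..<k]"

text \<open>The instance set acts as a promise: behaviour on other inputs is irrelevant.
  The size of an input is \<open>size\<close> of its encoding, its number of \<open>Pair\<close> nodes.\<close>

record 'i problem =
  instances :: "'i set"
  encode :: "'i \<Rightarrow> val"
  yes :: "'i \<Rightarrow> bool"

definition decides_in_time :: "com \<Rightarrow> 'i problem \<Rightarrow> ('i \<Rightarrow> real) \<Rightarrow> bool" where
  "decides_in_time c P t \<longleftrightarrow>
     (\<forall>I\<in>instances P. \<exists>m. runs c (encode P I) (enc_bool (yes P I)) m \<and> real m \<le> t I)"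

definition solvable_in_O_star :: "'i problem \<Rightarrow> ('i \<Rightarrow> real) \<Rightarrow> bool" where
  "solvable_in_O_star P g \<longleftrightarrow>
     (\<exists>c. \<exists>p :: nat poly.
        decides_in_time c P (\<lambda>I. g I * real (poly p (size (encode P I)))))"

definition computable2 :: "(nat \<Rightarrow> nat \<Rightarrow> nat) \<Rightarrow> bool" where
  "computable2 f \<longleftrightarrow>
     (\<exists>c. \<forall>a b. \<exists>m. runs c (Pair (enc_nat a) (enc_nat b)) (enc_nat (f a b)) m)"

definition fixed_parameter_tractable ::
  "'i problem \<Rightarrow> ('i \<Rightarrow> nat) \<Rightarrow> ('i \<Rightarrow> nat) \<Rightarrow> bool" where
  "fixed_parameter_tractable P \<kappa> \<rho> \<longleftrightarrow>
     (\<exists>f. computable2 f \<and> solvable_in_O_star P (\<lambda>I. real (f (\<kappa> I) (\<rho> I))))"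

text \<open>Steps are numbered \<open>0, \<dots>, k - 1\<close> and users \<open>0, \<dots>, n - 1\<close>.  Levels are numbered
  from 0, so \<open>levels ! q\<close> and \<open>level_constraints ! q\<close> belong to the relation with
  index \<open>q + 1\<close>.  Constraints are given implicitly: each one comes with a code, and
  only its scope and its code are part of the input seen by a program.  A representation
  scheme \<open>rep\<close> says which codes \<open>d\<close> represent a constraint \<open>c\<close> over \<open>n\<close> users
  (\<open>rep n c d\<close>).\<close>

type_synonym representation = "nat \<Rightarrow> (nat, nat) wconstraint \<Rightarrow> val \<Rightarrow> bool"

record ncwsp =
  num_steps :: nat
  num_users :: nat
  auths :: "nat \<Rightarrow> nat set"
  levels :: "(nat \<times> nat) set list"
  level_constraints :: "((nat, nat) wconstraint \<times> val) list list"

definition num_levels :: "ncwsp \<Rightarrow> nat" where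
  "num_levels I = length (levels I)"

definition workflow_of :: "ncwsp \<Rightarrow> (nat, nat) workflow" where
  "workflow_of I =
     \<lparr>steps = {..<num_steps I}, users = {..<num_users I}, auth = auths I,
      constraints = (\<Union>q<num_levels I. fst ` set (level_constraints I ! q))\<rparr>"

definition ncwsp_instance :: "representation \<Rightarrow> ncwsp \<Rightarrow> bool" where
  "ncwsp_instance rep I \<longleftrightarrow>
     (let U = {..<num_users I}; r = num_levels I; R = (\<lambda>q. levels I ! q) in
      wf_workflow (workflow_of I) \<and>
      r \<ge> 1 \<and>
      (\<forall>q<r. equiv U (R q)) \<and>
      (\<forall>q. q + 1 < r \<longrightarrow> refinement (R (q + 1)) (R q)) \<and>
      R (r - 1) = Id_on U \<and>
      length (level_constraints I) = r \<and>
      (\<forall>q<r. \<forall>(c, d) \<in> set (level_constraints I ! q).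
         class_independent U (R q) c \<and> rep (num_users I) c d))"

definition enc_constraint :: "nat \<Rightarrow> (nat, nat) wconstraint \<times> val \<Rightarrow> val" where
  "enc_constraint k = (\<lambda>((T, \<Theta>), d). Pair (enc_set k T) d)"

definition enc_ncwsp :: "ncwsp \<Rightarrow> val" where
  "enc_ncwsp I =
     (let k = num_steps I; n = num_users I in
      Pair (enc_nat k)
       (Pair (enc_nat n)
         (Pair (enc_list (\<lambda>u. enc_set k (auths I u)) [0..<n])
           (Pair (enc_list (enc_rel n) (levels I))
              (enc_list (enc_list (enc_constraint k)) (level_constraints I))))))"

definition nested_ci_wsp :: "representation \<Rightarrow> ncwsp problem" where
  "nested_ci_wsp rep =
     \<lparr>instances = {I. ncwsp_instance rep I},
      encode = enc_ncwsp,
      yes = (\<lambda>I. \<exists>\<pi>. valid_plan (workflow_of I) \<pi>)\<rparr>"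

text \<open>A single program, given \<open>n\<close>, a represented constraint and a plan, checks in time
  polynomial in \<open>n\<close> whether the plan satisfies the constraint.\<close>

definition poly_time_checkable :: "representation \<Rightarrow> bool" where
  "poly_time_checkable rep \<longleftrightarrow>
     (\<exists>chk. \<exists>p :: nat poly. \<forall>k n c d.
        k \<le> n \<and> wf_constraint {..<k} {..<n} c \<and> rep n c d \<longrightarrow>
        (\<forall>\<pi> \<in> {..<k} \<rightarrow>\<^sub>E {..<n}. \<exists>m.
           runs chk (Pair (enc_nat n) (Pair (enc_constraint k (c, d)) (enc_plan k \<pi>)))
             (enc_bool (satisfies \<pi> c)) m \<and>
           m \<le> poly p n))"

end

theory Submission imports Defs "HOL-Library.List_Lexorder" begin

text \<open>Give every user the key listing the least members of its classes at levels \<open>1, \<dots>, r\<close>; in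
  the lexicographic order of keys, all classes are intervals.  List the steps in the order of the
  keys of their users under a plan, and record for consecutive steps the number \<open>l \<in> {0, \<dots>, r}\<close> of
  levels on which their users are equivalent (\<open>l = r\<close> means the same user).  There are at most
  \<open>((r + 1) k) ^ k\<close> such codes, and a code determines on which levels any two steps get equivalent
  users, hence by class-independence which constraints hold.  Since the order already forces
  different blocks of steps to use different classes, no matching problem arises: an authorized plan
  with a given code is a path through the users, found by dynamic programming in polynomial time.
  One such plan per code is checked explicitly.\<close>

section \<open>Computations in polynomial time\<close>

text \<open>All prefixes of keys increase weakly along a chain of users, so a class that has been
  left is never entered again. Hence the global demand that different blocks of steps get different
  classes reduces to a condition on consecutive users, and the last user is all that a table of
  partial plans has to remember.

  The checker for constraints is a black box that takes a concrete plan, so a code cannot be tested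
  as a pattern; it is tested on whatever plan the table yields. Soundness is then immediate, and
  class-independence enters only in completeness: a valid plan has a code, the table yields some
  plan with this code, and both satisfy the same constraints.

  The bound counts all sequences of k pairs of a step and a number, repetitions of steps included,
  so that codes are the numerals with k digits in base (r + 1) k and can be enumerated by a counter.
  The outer loop is not polynomial, so time is handled in two layers: a calculus of polynomial-time
  functions for one round, and an explicit count for the loop.\<close>

lemma poly_nat_mono: "x \<le> y \<Longrightarrow> poly p x \<le> poly (p :: nat poly) y"
  by (induction p) (auto intro!: add_mono mult_mono)

definition poly_bounded :: "(nat \<Rightarrow> nat) \<Rightarrow> bool" where
  "poly_bounded g \<longleftrightarrow> (\<exists>p. \<forall>x. g x \<le> poly p x)"

named_theorems poly_bounded_intros

lemma poly_bounded_const [poly_bounded_intros]: "poly_bounded (\<lambda>_. c)"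
  unfolding poly_bounded_def by (rule exI[of _ "[:c:]"]) simp

lemma poly_bounded_ident [poly_bounded_intros]: "poly_bounded (\<lambda>x. x)"
  unfolding poly_bounded_def by (rule exI[of _ "[:0, 1:]"]) simp

lemma poly_bounded_add [poly_bounded_intros]:
  assumes "poly_bounded f" "poly_bounded g"
  shows "poly_bounded (\<lambda>x. f x + g x)"
  using assms unfolding poly_bounded_def by (metis add_mono poly_add)

lemma poly_bounded_Suc [poly_bounded_intros]:
  "poly_bounded f \<Longrightarrow> poly_bounded (\<lambda>x. Suc (f x))"
  using poly_bounded_add[OF _ poly_bounded_const[of 1]] by simp

lemma poly_bounded_mult [poly_bounded_intros]:
  assumes "poly_bounded f" "poly_bounded g"
  shows "poly_bounded (\<lambda>x. f x * g x)"
  using assms unfolding poly_bounded_def by (metis mult_mono poly_mult zero_le)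

lemma poly_bounded_poly [poly_bounded_intros]:
  assumes "poly_bounded f"
  shows "poly_bounded (\<lambda>x. poly p (f x))"
proof -
  obtain q where "\<forall>x. f x \<le> poly q x" using assms unfolding poly_bounded_def by blast
  then have "\<forall>x. poly p (f x) \<le> poly (pcompose p q) x"
    by (simp add: poly_pcompose poly_nat_mono)
  then show ?thesis unfolding poly_bounded_def by blast
qed

section \<open>Independence of a run from the variables that do not occur in it\<close>

fun exp_bound :: "exp \<Rightarrow> nat" where
  "exp_bound (EVar x) = Suc x"
| "exp_bound ENil = 0"
| "exp_bound (ECons e f) = max (exp_bound e) (exp_bound f)"
| "exp_bound (EHd e) = exp_bound e"
| "exp_bound (ETl e) = exp_bound e"

fun com_bound :: "com \<Rightarrow> nat" where
  "com_bound Skip = 0"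
| "com_bound (Assign x e) = max (Suc x) (exp_bound e)"
| "com_bound (Seq c d) = max (com_bound c) (com_bound d)"
| "com_bound (Cond e c d) = max (exp_bound e) (max (com_bound c) (com_bound d))"
| "com_bound (While e c) = max (exp_bound e) (com_bound c)"

lemma eval_exp_cong:
  "exp_bound e \<le> K \<Longrightarrow> \<forall>x<K. s' x = s x \<Longrightarrow> eval_exp e s' = eval_exp e s"
  by (induction e) auto

text \<open>Only variables below \<open>com_bound c\<close> are ever read or written.
  \<open>runs\<close> starts with all variables but 0 nil, so this is what lets a program known
  through \<open>runs\<close> work next to data kept in higher variables.\<close>

lemma exec_frame:
  assumes "exec c s m t" "com_bound c \<le> K" "\<forall>x<K. s' x = s x"
  shows "exec c s' m (\<lambda>x. if x < K then t x else s' x)"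
  using assms
proof (induction arbitrary: s')
  case (Skip s)
  then have "(\<lambda>x. if x < K then s x else s' x) = s'" by auto
  then show ?case using exec.Skip by metis
next
  case (Assign x e s)
  then have "(\<lambda>y. if y < K then (s(x := eval_exp e s)) y else s' y) = s'(x := eval_exp e s')"
    using eval_exp_cong[of e K s' s] by auto
  then show ?case using exec.Assign by metis
next
  case (Seq c s m t d m' u)
  let ?t = "\<lambda>x. if x < K then t x else s' x"
  have "exec c s' m ?t" using Seq by simp
  moreover have "exec d ?t m' (\<lambda>x. if x < K then u x else ?t x)" using Seq by simp
  moreover have "(\<lambda>x. if x < K then u x else ?t x) = (\<lambda>x. if x < K then u x else s' x)" by auto
  ultimately show ?case using exec.Seq by metis
next
  case (CondTrue e s c m t d)
  then have "eval_exp e s' \<noteq> Atom" using eval_exp_cong[of e K s' s] by simp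
  then show ?case using CondTrue by (intro exec.CondTrue) auto
next
  case (CondFalse e s d m t c)
  then have "eval_exp e s' = Atom" using eval_exp_cong[of e K s' s] by simp
  then show ?case using CondFalse by (intro exec.CondFalse) auto
next
  case (WhileFalse e s c)
  then have "eval_exp e s' = Atom" using eval_exp_cong[of e K s' s] by simp
  moreover have "(\<lambda>x. if x < K then s x else s' x) = s'" using WhileFalse by auto
  ultimately show ?case using exec.WhileFalse by metis
next
  case (WhileTrue e s c m t m' u)
  let ?t = "\<lambda>x. if x < K then t x else s' x"
  have "eval_exp e s' \<noteq> Atom" using WhileTrue eval_exp_cong[of e K s' s] by simp
  moreover have "exec c s' m ?t" using WhileTrue by simp
  moreover have "exec (While e c) ?t m' (\<lambda>x. if x < K then u x else ?t x)"
    using WhileTrue by simp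
  moreover have "(\<lambda>x. if x < K then u x else ?t x) = (\<lambda>x. if x < K then u x else s' x)" by auto
  ultimately show ?case using exec.WhileTrue by metis
qed

text \<open>Unlike \<open>runs\<close>, \<open>clean_run\<close> leaves all work variables nil and ignores the variables
  from \<open>K\<close> on, so that programs compose and can keep data aside.  The flag \<open>b\<close> says whether
  the time bound \<open>M\<close> is enforced.\<close>

definition clean_run :: "bool \<Rightarrow> nat \<Rightarrow> com \<Rightarrow> val \<Rightarrow> val \<Rightarrow> nat \<Rightarrow> bool" where
  "clean_run b K c u v M \<longleftrightarrow>
     (\<forall>s. s 0 = u \<longrightarrow> (\<forall>x. 0 < x \<and> x < K \<longrightarrow> s x = Atom) \<longrightarrow>
       (\<exists>m. exec c s m (s(0 := v)) \<and> (b \<longrightarrow> m \<le> M)))"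

lemma clean_runD:
  "clean_run b K c u v M \<Longrightarrow> s 0 = u \<Longrightarrow> (\<And>x. 0 < x \<Longrightarrow> x < K \<Longrightarrow> s x = Atom) \<Longrightarrow>
    \<exists>m. exec c s m (s(0 := v)) \<and> (b \<longrightarrow> m \<le> M)"
  unfolding clean_run_def by blast

lemma clean_run_mono:
  "clean_run b K c u v M \<Longrightarrow> K \<le> K' \<Longrightarrow> (b \<Longrightarrow> M \<le> M') \<Longrightarrow> clean_run b K' c u v M'"
  unfolding clean_run_def by (metis le_trans less_le_trans)

lemma clean_run_runs:
  assumes "clean_run b K c u v M"
  shows "\<exists>m. runs c u v m \<and> (b \<longrightarrow> m \<le> M)"
proof -
  obtain m where "exec c ((\<lambda>_. Atom)(0 := u)) m ((\<lambda>_. Atom)(0 := u, 0 := v))" "b \<longrightarrow> m \<le> M"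
    using clean_runD[OF assms, of "(\<lambda>_. Atom)(0 := u)"] by auto
  then show ?thesis unfolding runs_def by (metis fun_upd_same)
qed

lemma exec_AssignI: "t = s(x := eval_exp e s) \<Longrightarrow> m = exp_cost e + 1 \<Longrightarrow> exec (Assign x e) s m t"
  using exec.Assign by simp

text \<open>Variable 0 holds the result and is spared; the others are reset so that a foreign
  program meets the contract of \<open>clean_run\<close>.\<close>

fun clear :: "nat \<Rightarrow> com" where
  "clear 0 = Skip"
| "clear (Suc x) = Seq (clear x) (if x = 0 then Skip else Assign x ENil)"

lemma exec_clear:
  "\<exists>m \<le> 2 * K + 1. exec (clear K) s m (\<lambda>x. if 0 < x \<and> x < K then Atom else s x)"
proof (induction K)
  case 0
  then show ?case using exec.Skip[of s] by auto
next
  case (Suc K)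
  let ?t = "\<lambda>x. if 0 < x \<and> x < K then Atom else s x"
  let ?u = "\<lambda>x. if 0 < x \<and> x < Suc K then Atom else s x"
  obtain m where m: "m \<le> 2 * K + 1" "exec (clear K) s m ?t" using Suc by blast
  have "\<exists>m' \<le> 2. exec (if K = 0 then Skip else Assign K ENil) ?t m' ?u"
  proof (cases "K = 0")
    case True
    then have "?t = ?u" by auto
    then have "exec Skip ?t 1 ?u" using exec.Skip by metis
    then show ?thesis using True by (intro exI[of _ 1]) simp
  next
    case False
    have "?t(K := Atom) = ?u" using False by auto
    then have "exec (Assign K ENil) ?t 2 ?u" by (intro exec_AssignI) simp_all
    then show ?thesis using False by (intro exI[of _ 2]) simp
  qed
  then obtain m' where "m' \<le> 2" "exec (if K = 0 then Skip else Assign K ENil) ?t m' ?u" by blast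
  then have "exec (clear (Suc K)) s (m + m') ?u" using exec.Seq[OF m(2)] by simp
  then show ?case using m(1) \<open>m' \<le> 2\<close> by (intro exI[of _ "m + m'"]) auto
qed

text \<open>Connects the checker, known only through \<open>runs\<close>, to the calculus: clearing
  its finitely many variables afterwards costs a constant \<open>C\<close> that depends on the
  program alone.\<close>

lemma runs_clean_run:
  "\<exists>c' K C. \<forall>u v m. runs c u v m \<longrightarrow> clean_run b K c' u v (m + C)"
proof -
  define K where "K = max 1 (com_bound c)"
  have "clean_run b K (Seq c (clear K)) u v (m + (2 * K + 1))" if r: "runs c u v m" for u v m
    unfolding clean_run_def
  proof (intro allI impI)
    obtain t where t: "exec c ((\<lambda>_. Atom)(0 := u)) m t" "t 0 = v" using r unfolding runs_def by blast
    fix s :: state assume s: "s 0 = u" "\<forall>x. 0 < x \<and> x < K \<longrightarrow> s x = Atom"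
    let ?t = "\<lambda>x. if x < K then t x else s x"
    have 1: "exec c s m ?t"
      by (rule exec_frame[OF t(1)]) (use s K_def in auto)
    obtain m' where m': "m' \<le> 2 * K + 1"
      "exec (clear K) ?t m' (\<lambda>x. if 0 < x \<and> x < K then Atom else ?t x)"
      using exec_clear by blast
    have "(\<lambda>x. if 0 < x \<and> x < K then Atom else ?t x) = s(0 := v)"
      using s t(2) K_def by (auto simp: fun_eq_iff)
    then show "\<exists>m'. exec (Seq c (clear K)) s m' (s(0 := v)) \<and> (b \<longrightarrow> m' \<le> m + (2 * K + 1))"
      using exec.Seq[OF 1 m'(2)] m'(1) by auto
  qed
  then show ?thesis by blast
qed

section \<open>Clean runs of composed programs\<close>

lemma clean_run_Assign:
  assumes "exp_bound e \<le> 1"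
  shows "clean_run b K (Assign 0 e) u (eval_exp e (\<lambda>_. u)) (exp_cost e + 1)"
  unfolding clean_run_def
proof (intro allI impI)
  fix s :: state assume "s 0 = u"
  then have "eval_exp e (\<lambda>_. u) = eval_exp e s" by (intro eval_exp_cong[OF assms]) auto
  then show "\<exists>m. exec (Assign 0 e) s m (s(0 := eval_exp e (\<lambda>_. u))) \<and> (b \<longrightarrow> m \<le> exp_cost e + 1)"
    using exec.Assign[of 0 e s] by auto
qed

lemma clean_run_Seq:
  assumes "clean_run b K c u v M" "clean_run b K d v w M'"
  shows "clean_run b K (Seq c d) u w (M + M')"
  unfolding clean_run_def
proof (intro allI impI)
  fix s :: state assume s: "s 0 = u" "\<forall>x. 0 < x \<and> x < K \<longrightarrow> s x = Atom"
  obtain m where m: "exec c s m (s(0 := v))" "b \<longrightarrow> m \<le> M"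
    using clean_runD[OF assms(1), of s] s by blast
  obtain m' where m': "exec d (s(0 := v)) m' (s(0 := v, 0 := w))" "b \<longrightarrow> m' \<le> M'"
    using clean_runD[OF assms(2), of "s(0 := v)"] s(2) by auto
  have "exec (Seq c d) s (m + m') (s(0 := w))" using exec.Seq[OF m(1) m'(1)] by simp
  then show "\<exists>m. exec (Seq c d) s m (s(0 := w)) \<and> (b \<longrightarrow> m \<le> M + M')"
    using m(2) m'(2) by (intro exI[of _ "m + m'"]) auto
qed

text \<open>\<open>K\<close> saves the input for \<open>d\<close> while \<open>c\<close> runs, and
  \<open>K + 1\<close> saves the result of \<open>c\<close> while \<open>d\<close> runs. Both lie
  outside the work variables of the two programs and are nil again at the end.\<close>

definition pair_com :: "nat \<Rightarrow> com \<Rightarrow> com \<Rightarrow> com" where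
  "pair_com K c d =
     Seq (Assign K (EVar 0)) (Seq c (Seq (Assign (K+1) (EVar 0)) (Seq (Assign 0 (EVar K))
      (Seq (Assign K ENil) (Seq d (Seq (Assign 0 (ECons (EVar (K+1)) (EVar 0)))
       (Assign (K+1) ENil)))))))"

lemma clean_run_pair:
  assumes "clean_run b K c u x M" "clean_run b K d u y M'" "1 \<le> K"
  shows "clean_run b (K + 2) (pair_com K c d) u (Pair x y) (M + M' + 14)"
  unfolding clean_run_def
proof (intro allI impI)
  fix s :: state assume s: "s 0 = u" "\<forall>z. 0 < z \<and> z < K + 2 \<longrightarrow> s z = Atom"
  have sK: "s K = Atom" "s (Suc K) = Atom" using s(2) assms(3) by auto
  let ?s = "s(K := u)" and ?t = "s(K + 1 := x, 0 := u)"
  obtain m where m: "exec c ?s m (?s(0 := x))" "b \<longrightarrow> m \<le> M"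
    using clean_runD[OF assms(1), of ?s] s assms(3) by auto
  obtain m' where m': "exec d ?t m' (?t(0 := y))" "b \<longrightarrow> m' \<le> M'"
    using clean_runD[OF assms(2), of ?t] s assms(3) by auto
  have "exec (pair_com K c d) s (2 + (m + (2 + (2 + (2 + (m' + (4 + 2))))))) (s(0 := Pair x y))"
    unfolding pair_com_def
    apply (rule exec.Seq, rule exec_AssignI, rule refl, simp)
    apply (rule exec.Seq) using m(1) s(1) apply simp
    apply (rule exec.Seq, rule exec_AssignI, rule refl, simp)
    apply (rule exec.Seq, rule exec_AssignI, rule refl, simp)
    apply (rule exec.Seq, rule exec_AssignI[of ?t])
    using sK assms(3) s(1) apply (simp add: fun_eq_iff) apply simp
    apply (rule exec.Seq, rule m'(1))
    apply (rule exec.Seq, rule exec_AssignI, rule refl, simp)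
    apply (rule exec_AssignI)
    using s sK assms(3) by (auto simp: fun_eq_iff)
  then show "\<exists>m. exec (pair_com K c d) s m (s(0 := Pair x y)) \<and> (b \<longrightarrow> m \<le> M + M' + 14)"
    using m(2) m'(2) by (intro exI conjI) auto
qed

lemma clean_run_Cond:
  assumes "eval_exp e (\<lambda>_. u) \<noteq> Atom \<Longrightarrow> clean_run b K c u v M"
    and "eval_exp e (\<lambda>_. u) = Atom \<Longrightarrow> clean_run b K d u v M" and e: "exp_bound e \<le> 1"
  shows "clean_run b K (Cond e c d) u v (exp_cost e + 1 + M)"
  unfolding clean_run_def
proof (intro allI impI)
  fix s :: state assume s: "s 0 = u" "\<forall>z. 0 < z \<and> z < K \<longrightarrow> s z = Atom"
  then have eq: "eval_exp e (\<lambda>_. u) = eval_exp e s" by (intro eval_exp_cong[OF e]) auto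
  show "\<exists>m. exec (Cond e c d) s m (s(0 := v)) \<and> (b \<longrightarrow> m \<le> exp_cost e + 1 + M)"
  proof (cases "eval_exp e s = Atom")
    case True
    then obtain m where "exec d s m (s(0 := v))" "b \<longrightarrow> m \<le> M"
      using clean_runD[OF assms(2), of s] s eq by auto
    then show ?thesis using exec.CondFalse[OF True] by (intro exI[of _ "exp_cost e + 1 + m"]) auto
  next
    case False
    then obtain m where "exec c s m (s(0 := v))" "b \<longrightarrow> m \<le> M"
      using clean_runD[OF assms(1), of s] s eq by auto
    then show ?thesis using exec.CondTrue[OF False] by (intro exI[of _ "exp_cost e + 1 + m"]) auto
  qed
qed

text \<open>A program has a single input, so the element, the accumulator and a fixed parameter are
  packed into one tree for each call of \<open>c\<close>. The remaining list stays in
  \<open>K\<close>, the parameter in \<open>K + 1\<close>.\<close>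

definition fold_body :: "nat \<Rightarrow> com \<Rightarrow> com" where
  "fold_body K c =
     Seq (Assign 0 (ECons (EHd (EVar K)) (ECons (EVar 0) (EVar (K+1)))))
      (Seq c (Assign K (ETl (EVar K))))"

definition fold_com :: "nat \<Rightarrow> com \<Rightarrow> com" where
  "fold_com K c =
     Seq (Assign K (EHd (EVar 0))) (Seq (Assign (K+1) (ETl (ETl (EVar 0))))
      (Seq (Assign 0 (EHd (ETl (EVar 0)))) (Seq (While (EVar K) (fold_body K c))
       (Assign (K+1) ENil))))"

text \<open>The hypothesis on \<open>c\<close> speaks only of accumulators that actually occur,
  namely after a prefix \<open>ys\<close> of the list; this is what later admits invariants and size
  bounds for them. A round costs 12 beyond \<open>c\<close>: 2 for the loop test and 10 for packing
  and advancing.\<close>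

lemma exec_fold_loop:
  assumes "\<And>ys x zs. xs = ys @ x # zs \<Longrightarrow>
      clean_run b K c (Pair (eX x) (Pair (eY (fold g ys y)) A)) (eY (g x (fold g ys y))) M"
    and "1 \<le> K" "s K = enc_list eX xs" "s (Suc K) = A" "s 0 = eY y"
    and "\<forall>x. 0 < x \<and> x < K \<longrightarrow> s x = Atom"
  shows "\<exists>m. exec (While (EVar K) (fold_body K c)) s m (s(0 := eY (fold g xs y), K := Atom)) \<and>
     (b \<longrightarrow> m \<le> length xs * (M + 12) + 2)"
  using assms
proof (induction xs arbitrary: y s)
  case Nil
  have "s(0 := eY y, K := Atom) = s" using Nil by auto
  moreover have "exec (While (EVar K) (fold_body K c)) s 2 s"
    using exec.WhileFalse[of "EVar K" s "fold_body K c"] Nil by (simp add: numeral_2_eq_2)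
  ultimately have "exec (While (EVar K) (fold_body K c)) s 2 (s(0 := eY y, K := Atom))" by metis
  then show ?case by (intro exI[of _ 2]) (simp only: fold_simps, simp)
next
  case (Cons x xs)
  let ?u = "s(0 := Pair (eX x) (Pair (eY y) A))"
  let ?s = "s(0 := eY (g x y), K := enc_list eX xs)"
  obtain m where m: "exec c ?u m (?u(0 := eY (g x y)))" "b \<longrightarrow> m \<le> M"
    using clean_runD[OF Cons.prems(1)[of "[]" x xs], of ?u] Cons.prems by auto
  have "exec (fold_body K c) s (7 + (m + 3)) ?s"
    unfolding fold_body_def
    apply (rule exec.Seq, rule exec_AssignI[of ?u])
    using Cons.prems apply simp apply simp
    apply (rule exec.Seq, rule m(1))
    apply (rule exec_AssignI)
    using Cons.prems by (auto simp: fun_eq_iff)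
  then have body: "exec (fold_body K c) s (m + 10) ?s" by (simp add: add.commute)
  have "\<exists>m. exec (While (EVar K) (fold_body K c)) ?s m (?s(0 := eY (fold g xs (g x y)), K := Atom)) \<and>
     (b \<longrightarrow> m \<le> length xs * (M + 12) + 2)"
  proof (rule Cons.IH)
    fix ys x' zs assume "xs = ys @ x' # zs"
    then show "clean_run b K c (Pair (eX x') (Pair (eY (fold g ys (g x y))) A))
        (eY (g x' (fold g ys (g x y)))) M"
      using Cons.prems(1)[of "x # ys" x' zs] by simp
  qed (use Cons.prems in auto)
  then obtain m' where m': "exec (While (EVar K) (fold_body K c)) ?s m'
      (?s(0 := eY (fold g xs (g x y)), K := Atom))" "b \<longrightarrow> m' \<le> length xs * (M + 12) + 2" by blast
  have "?s(0 := eY (fold g xs (g x y)), K := Atom) = s(0 := eY (fold g (x # xs) y), K := Atom)"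
    using Cons.prems by (auto simp: fun_eq_iff)
  then have "exec (While (EVar K) (fold_body K c)) s (exp_cost (EVar K) + 1 + (m + 10) + m')
      (s(0 := eY (fold g (x # xs) y), K := Atom))"
    using exec.WhileTrue[OF _ body m'(1)] Cons.prems(3) by simp
  moreover have "b \<longrightarrow> exp_cost (EVar K) + 1 + (m + 10) + m' \<le> length (x # xs) * (M + 12) + 2"
    using m(2) m'(2) by auto
  ultimately show ?case by blast
qed

lemma clean_run_fold:
  assumes c: "\<And>ys x zs. xs = ys @ x # zs \<Longrightarrow>
      clean_run b K c (Pair (eX x) (Pair (eY (fold g ys y)) A)) (eY (g x (fold g ys y))) M"
    and K: "1 \<le> K"
  shows "clean_run b (K + 2) (fold_com K c) (Pair (enc_list eX xs) (Pair (eY y) A))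
      (eY (fold g xs y)) (length xs * (M + 12) + 15)"
  unfolding clean_run_def
proof (intro allI impI)
  fix s :: state
  assume s: "s 0 = Pair (enc_list eX xs) (Pair (eY y) A)"
    "\<forall>z. 0 < z \<and> z < K + 2 \<longrightarrow> s z = Atom"
  have sK: "s K = Atom" "s (Suc K) = Atom" using s(2) K by auto
  let ?s = "s(K := enc_list eX xs, K + 1 := A, 0 := eY y)"
  have "\<exists>m. exec (While (EVar K) (fold_body K c)) ?s m (?s(0 := eY (fold g xs y), K := Atom)) \<and>
      (b \<longrightarrow> m \<le> length xs * (M + 12) + 2)"
    by (rule exec_fold_loop) (use c s K in auto)
  then obtain m where m:
    "exec (While (EVar K) (fold_body K c)) ?s m (?s(0 := eY (fold g xs y), K := Atom))"
    "b \<longrightarrow> m \<le> length xs * (M + 12) + 2" by blast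
  have "exec (fold_com K c) s (3 + (4 + (4 + (m + 2)))) (s(0 := eY (fold g xs y)))"
    unfolding fold_com_def
    apply (rule exec.Seq, rule exec_AssignI, rule refl, simp)
    apply (rule exec.Seq, rule exec_AssignI, rule refl, simp)
    apply (rule exec.Seq, rule exec_AssignI[of ?s])
    using s K apply simp apply simp
    apply (rule exec.Seq, rule m(1))
    apply (rule exec_AssignI)
    using s sK K by (auto simp: fun_eq_iff)
  then show "\<exists>m. exec (fold_com K c) s m (s(0 := eY (fold g xs y))) \<and>
      (b \<longrightarrow> m \<le> length xs * (M + 12) + 15)"
    using m(2) by (intro exI conjI) auto
qed

text \<open>For \<open>b = False\<close> this is plain computability, for \<open>b = True\<close> computability in polynomial
  time with polynomially bounded output.  The output bound is a separate demand because of
  sharing: programs can double the size of a tree in each step.\<close>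

definition computes ::
  "bool \<Rightarrow> 'a set \<Rightarrow> ('a \<Rightarrow> val) \<Rightarrow> ('a \<Rightarrow> 'b) \<Rightarrow> ('b \<Rightarrow> val) \<Rightarrow> bool" where
  "computes b D eA f eB \<longleftrightarrow> (\<exists>c K p. 1 \<le> K \<and> (\<forall>a\<in>D.
     clean_run b K c (eA a) (eB (f a)) (poly p (size (eA a))) \<and>
     (b \<longrightarrow> size (eB (f a)) \<le> poly p (size (eA a)))))"

lemma computesI:
  assumes "\<And>a. a \<in> D \<Longrightarrow> clean_run b K c (eA a) (eB (f a)) (t (size (eA a)))"
    and "\<And>a. a \<in> D \<Longrightarrow> b \<Longrightarrow> size (eB (f a)) \<le> t' (size (eA a))"
    and "poly_bounded t" "poly_bounded t'"
  shows "computes b D eA f eB"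
proof -
  obtain p p' where p: "\<And>x. t x \<le> poly p x" "\<And>x. t' x \<le> poly p' x"
    using assms(3,4) unfolding poly_bounded_def by blast
  have "clean_run b (max 1 K) c (eA a) (eB (f a)) (poly (p + p') (size (eA a)))" if "a \<in> D" for a
    by (rule clean_run_mono[OF assms(1)[OF that]]) (simp_all add: p trans_le_add1)
  moreover have "size (eB (f a)) \<le> poly (p + p') (size (eA a))" if "a \<in> D" b for a
    using assms(2)[OF that] p(2) by (simp add: le_trans trans_le_add2)
  ultimately show ?thesis unfolding computes_def
    by (intro exI[of _ c] exI[of _ "max 1 K"] exI[of _ "p + p'"]) auto
qed

text \<open>Offers every larger \<open>K'\<close>, so that two programs can be run over a common
  boundary between work variables and saved data.\<close>

lemma computesE:
  assumes "computes b D eA f eB"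
  obtains K c p where "1 \<le> K"
    "\<And>a K'. a \<in> D \<Longrightarrow> K \<le> K' \<Longrightarrow> clean_run b K' c (eA a) (eB (f a)) (poly p (size (eA a)))"
    "\<And>a. a \<in> D \<Longrightarrow> b \<Longrightarrow> size (eB (f a)) \<le> poly p (size (eA a))"
proof -
  obtain c K p where *: "1 \<le> K" "\<And>a. a \<in> D \<Longrightarrow> clean_run b K c (eA a) (eB (f a)) (poly p (size (eA a)))"
    "\<And>a. a \<in> D \<Longrightarrow> b \<Longrightarrow> size (eB (f a)) \<le> poly p (size (eA a))"
    using assms unfolding computes_def by blast
  show thesis by (rule that[OF *(1) _ *(3)]) (use *(2) clean_run_mono in blast)+
qed

section \<open>Closure properties of polynomial-time functions\<close>

lemma computes_subset: "computes b D eA f eB \<Longrightarrow> D' \<subseteq> D \<Longrightarrow> computes b D' eA f eB"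
  unfolding computes_def by (meson subsetD)

lemma computes_cong:
  "computes b D eA f eB \<Longrightarrow> (\<And>a. a \<in> D \<Longrightarrow> eA' a = eA a) \<Longrightarrow>
    (\<And>a. a \<in> D \<Longrightarrow> eB' (f' a) = eB (f a)) \<Longrightarrow> computes b D eA' f' eB'"
  unfolding computes_def by (metis (no_types, lifting))

text \<open>The time of the second program is polynomial in the size of the first output, not of the
  input; the size clause of \<open>computes\<close> closes this gap.\<close>

lemma computes_comp:
  assumes f: "computes b D eA f eB" and g: "computes b E eB g eC"
    and sub: "\<And>a. a \<in> D \<Longrightarrow> f a \<in> E"
  shows "computes b D eA (\<lambda>a. g (f a)) eC"
proof -
  from f obtain c K p where f: "1 \<le> K"
    "\<And>a K'. a \<in> D \<Longrightarrow> K \<le> K' \<Longrightarrow> clean_run b K' c (eA a) (eB (f a)) (poly p (size (eA a)))"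
    "\<And>a. a \<in> D \<Longrightarrow> b \<Longrightarrow> size (eB (f a)) \<le> poly p (size (eA a))"
    by (rule computesE) blast
  from g obtain d L q where g: "1 \<le> L"
    "\<And>a K'. a \<in> E \<Longrightarrow> L \<le> K' \<Longrightarrow> clean_run b K' d (eB a) (eC (g a)) (poly q (size (eB a)))"
    "\<And>a. a \<in> E \<Longrightarrow> b \<Longrightarrow> size (eC (g a)) \<le> poly q (size (eB a))"
    by (rule computesE) blast
  let ?t = "\<lambda>x. poly p x + poly q (poly p x)"
  show ?thesis
  proof (rule computesI[where K = "max K L" and c = "Seq c d" and t = ?t and t' = ?t])
    fix a assume a: "a \<in> D"
    have le: "poly q (size (eB (f a))) \<le> poly q (poly p (size (eA a)))" if b
      by (rule poly_nat_mono) (use f(3) a that in blast)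
    have "clean_run b (max K L) d (eB (f a)) (eC (g (f a))) (poly q (poly p (size (eA a))))"
      by (rule clean_run_mono[OF g(2)[OF sub[OF a], of "max K L"]]) (use le in auto)
    then show "clean_run b (max K L) (Seq c d) (eA a) (eC (g (f a))) (?t (size (eA a)))"
      using f(2)[OF a] by (intro clean_run_Seq) auto
    show "size (eC (g (f a))) \<le> ?t (size (eA a))" if b
      using g(3)[OF sub[OF a] that] le[OF that] by linarith
  qed (intro poly_bounded_intros)+
qed

definition enc_prod :: "('a \<Rightarrow> val) \<Rightarrow> ('b \<Rightarrow> val) \<Rightarrow> 'a \<times> 'b \<Rightarrow> val" where
  "enc_prod eA eB p = Pair (eA (fst p)) (eB (snd p))"

lemma computes_pair:
  assumes f: "computes b D eA f eB" and g: "computes b D eA g eC"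
  shows "computes b D eA (\<lambda>a. (f a, g a)) (enc_prod eB eC)"
proof -
  from f obtain c K p where f: "1 \<le> K"
    "\<And>a K'. a \<in> D \<Longrightarrow> K \<le> K' \<Longrightarrow> clean_run b K' c (eA a) (eB (f a)) (poly p (size (eA a)))"
    "\<And>a. a \<in> D \<Longrightarrow> b \<Longrightarrow> size (eB (f a)) \<le> poly p (size (eA a))"
    by (rule computesE) blast
  from g obtain d L q where g: "1 \<le> L"
    "\<And>a K'. a \<in> D \<Longrightarrow> L \<le> K' \<Longrightarrow> clean_run b K' d (eA a) (eC (g a)) (poly q (size (eA a)))"
    "\<And>a. a \<in> D \<Longrightarrow> b \<Longrightarrow> size (eC (g a)) \<le> poly q (size (eA a))"
    by (rule computesE) blast
  let ?t = "\<lambda>x. poly p x + poly q x + 14"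
  show ?thesis
  proof (rule computesI[where K = "max K L + 2" and c = "pair_com (max K L) c d" and t = ?t and t' = ?t])
    fix a assume a: "a \<in> D"
    show "clean_run b (max K L + 2) (pair_com (max K L) c d) (eA a)
        (enc_prod eB eC (f a, g a)) (?t (size (eA a)))"
      unfolding enc_prod_def fst_conv snd_conv
      by (intro clean_run_pair f g a) (use f(1) in auto)
    show "size (enc_prod eB eC (f a, g a)) \<le> ?t (size (eA a))" if b
      using f(3)[OF a that] g(3)[OF a that] by (simp add: enc_prod_def)
  qed (intro poly_bounded_intros)+
qed

lemma computes_exp:
  assumes "exp_bound e \<le> 1" "\<And>a. a \<in> D \<Longrightarrow> eval_exp e (\<lambda>_. eA a) = eB (f a)"
    and "\<And>a. a \<in> D \<Longrightarrow> size (eB (f a)) \<le> t (size (eA a))" "poly_bounded t"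
  shows "computes b D eA f eB"
proof (rule computesI[where K = 1 and c = "Assign 0 e" and t = "\<lambda>_. exp_cost e + 1" and t' = t])
  show "clean_run b 1 (Assign 0 e) (eA a) (eB (f a)) (exp_cost e + 1)" if "a \<in> D" for a
    using clean_run_Assign[OF assms(1), of b 1 "eA a"] assms(2)[OF that] by simp
qed (use assms in \<open>auto intro: poly_bounded_intros\<close>)

lemma computes_id: "computes b D eA (\<lambda>a. a) eA"
  by (rule computes_exp[where e = "EVar 0" and t = "\<lambda>x. x"]) (auto intro: poly_bounded_intros)

lemma computes_const: "computes b D eA (\<lambda>_. x) eB"
proof -
  have "\<exists>e. exp_bound e = 0 \<and> (\<forall>s. eval_exp e s = v)" for v
  proof (induction v)
    case Atom
    then show ?case by (intro exI[of _ ENil]) auto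
  next
    case (Pair u v)
    then obtain e e' where "exp_bound e = 0" "\<forall>s. eval_exp e s = u"
      "exp_bound e' = 0" "\<forall>s. eval_exp e' s = v" by blast
    then show ?case by (intro exI[of _ "ECons e e'"]) auto
  qed
  then obtain e where "exp_bound e = 0" "\<forall>s. eval_exp e s = eB x" by blast
  then show ?thesis
    by (intro computes_exp[where e = e and t = "\<lambda>_. size (eB x)"]) (auto intro: poly_bounded_intros)
qed

lemma computes_fst:
  assumes "computes b D eA f (enc_prod eB eC)"
  shows "computes b D eA (\<lambda>a. fst (f a)) eB"
  by (rule computes_comp[OF assms, where E = UNIV],
      rule computes_exp[where e = "EHd (EVar 0)" and t = "\<lambda>x. x"])
    (auto simp: enc_prod_def intro: poly_bounded_intros)

lemma computes_snd:
  assumes "computes b D eA f (enc_prod eB eC)"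
  shows "computes b D eA (\<lambda>a. snd (f a)) eC"
  by (rule computes_comp[OF assms, where E = UNIV],
      rule computes_exp[where e = "ETl (EVar 0)" and t = "\<lambda>x. x"])
    (auto simp: enc_prod_def intro: poly_bounded_intros)

section \<open>Case distinctions and folds\<close>

lemma enc_bool_eq_Atom: "enc_bool x = Atom \<longleftrightarrow> \<not> x"
  by (cases x) auto

lemma size_enc_bool: "size (enc_bool x) \<le> 1"
  by (cases x) auto

text \<open>Each branch has to be computed only where its case holds, so partial operations such as
  \<open>hd\<close> may be guarded by a test. The program first builds the pair of the flag and the
  input, because evaluating \<open>P\<close> alone would overwrite the input.\<close>

lemma computes_if:
  assumes P: "computes b D eA P enc_bool"
    and f: "computes b {a \<in> D. P a} eA f eB" and g: "computes b {a \<in> D. \<not> P a} eA g eB"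
  shows "computes b D eA (\<lambda>a. if P a then f a else g a) eB"
proof -
  from f obtain c K p where f: "1 \<le> K"
    "\<And>a K'. a \<in> {a \<in> D. P a} \<Longrightarrow> K \<le> K' \<Longrightarrow> clean_run b K' c (eA a) (eB (f a)) (poly p (size (eA a)))"
    "\<And>a. a \<in> {a \<in> D. P a} \<Longrightarrow> b \<Longrightarrow> size (eB (f a)) \<le> poly p (size (eA a))"
    by (rule computesE) blast
  from g obtain d L q where g: "1 \<le> L"
    "\<And>a K'. a \<in> {a \<in> D. \<not> P a} \<Longrightarrow> L \<le> K' \<Longrightarrow> clean_run b K' d (eA a) (eB (g a)) (poly q (size (eA a)))"
    "\<And>a. a \<in> {a \<in> D. \<not> P a} \<Longrightarrow> b \<Longrightarrow> size (eB (g a)) \<le> poly q (size (eA a))"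
    by (rule computesE) blast
  let ?E = "{x. snd x \<in> D \<and> fst x = P (snd x)}"
  let ?drop = "Assign 0 (ETl (EVar 0))"
  let ?t = "\<lambda>x. 3 + (3 + (poly p x + poly q x))"
  have "computes b ?E (enc_prod enc_bool eA) (\<lambda>x. if fst x then f (snd x) else g (snd x)) eB"
  proof (rule computesI[where K = "max K L" and t = ?t and t' = ?t and
        c = "Cond (EHd (EVar 0)) (Seq ?drop c) (Seq ?drop d)"])
    fix x assume x: "x \<in> ?E"
    obtain h a where ha: "x = (h, a)" by (cases x)
    have a: "a \<in> D" and h: "h = P a" using x ha by auto
    let ?u = "Pair (enc_bool h) (eA a)" and ?v = "eB (if h then f a else g a)"
    have drop: "clean_run b (max K L) ?drop ?u (eA a) 3"
      using clean_run_Assign[of "ETl (EVar 0)" b "max K L" ?u] by (simp add: numeral_eq_Suc)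
    have pre: "clean_run b (max K L) (Seq ?drop e) ?u w (3 + (poly p (size ?u) + poly q (size ?u)))"
      if "clean_run b (max K L) e (eA a) w (poly r (size (eA a)))" "r = p \<or> r = q" for e w r
    proof (rule clean_run_Seq[OF drop clean_run_mono[OF that(1)]])
      have "poly r (size (eA a)) \<le> poly r (size ?u)" by (rule poly_nat_mono) simp
      then show "poly r (size (eA a)) \<le> poly p (size ?u) + poly q (size ?u)" using that(2) by auto
    qed simp
    have "clean_run b (max K L) (Cond (EHd (EVar 0)) (Seq ?drop c) (Seq ?drop d)) ?u ?v
        (exp_cost (EHd (EVar 0)) + 1 + (3 + (poly p (size ?u) + poly q (size ?u))))"
    proof (rule clean_run_Cond)
      assume "eval_exp (EHd (EVar 0)) (\<lambda>_. ?u) \<noteq> Atom"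
      then have "P a" using h by (simp add: enc_bool_eq_Atom)
      then show "clean_run b (max K L) (Seq ?drop c) ?u ?v (3 + (poly p (size ?u) + poly q (size ?u)))"
        using h a f(2)[of a "max K L"] by (intro pre[where r = p]) auto
    next
      assume "eval_exp (EHd (EVar 0)) (\<lambda>_. ?u) = Atom"
      then have "\<not> P a" using h by (simp add: enc_bool_eq_Atom)
      then show "clean_run b (max K L) (Seq ?drop d) ?u ?v (3 + (poly p (size ?u) + poly q (size ?u)))"
        using h a g(2)[of a "max K L"] by (intro pre[where r = q]) auto
    qed simp
    then show "clean_run b (max K L) (Cond (EHd (EVar 0)) (Seq ?drop c) (Seq ?drop d))
        (enc_prod enc_bool eA x) (eB (if fst x then f (snd x) else g (snd x)))
        (?t (size (enc_prod enc_bool eA x)))"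
      by (cases h) (simp_all add: ha enc_prod_def)
    show "size (eB (if fst x then f (snd x) else g (snd x))) \<le> ?t (size (enc_prod enc_bool eA x))" if b
    proof -
      have "poly r (size (eA a)) \<le> poly r (size ?u)" for r by (rule poly_nat_mono) simp
      from this[of p] this[of q] show ?thesis
        using f(3)[of a] g(3)[of a] that a h by (auto simp: ha enc_prod_def)
    qed
  qed (intro poly_bounded_intros)+
  from computes_comp[OF computes_pair[OF P computes_id] this] show ?thesis
    by (simp cong: if_cong)
qed

lemma size_enc_list: "size (enc_list e xs) = (\<Sum>x\<leftarrow>xs. Suc (size (e x)))"
  by (induction xs) auto

lemma length_le_size_enc_list: "length xs \<le> size (enc_list e xs)"
  by (induction xs) auto

lemma size_le_size_enc_list: "x \<in> set xs \<Longrightarrow> size (e x) \<le> size (enc_list e xs)"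
  by (induction xs) auto

lemma size_enc_list_le: "(\<And>x. x \<in> set xs \<Longrightarrow> size (e x) \<le> B) \<Longrightarrow> size (enc_list e xs) \<le> length xs * Suc B"
proof (induction xs)
  case (Cons x xs)
  then have "size (e x) \<le> B" "size (enc_list e xs) \<le> length xs * Suc B" by auto
  then show ?case by simp
qed simp

text \<open>Polynomially many polynomial steps may still blow up the accumulator exponentially, so a
  bound \<open>q\<close> on all intermediate values is a premise. The set \<open>E\<close> carries
  what is known about an element and the accumulator it meets.\<close>

lemma computes_fold:
  assumes l: "computes b D eA l (enc_list eX)" and i: "computes b D eA i eY"
    and g: "computes b E (enc_prod eX (enc_prod eY eA)) (\<lambda>p. g (fst p) (fst (snd p)) (snd (snd p))) eY"
    and E: "\<And>a ys x zs. a \<in> D \<Longrightarrow> l a = ys @ x # zs \<Longrightarrow> (x, fold (\<lambda>x y. g x y a) ys (i a), a) \<in> E"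
    and q: "b \<Longrightarrow> poly_bounded q"
    and sz: "\<And>a ys zs. b \<Longrightarrow> a \<in> D \<Longrightarrow> l a = ys @ zs \<Longrightarrow>
       size (eY (fold (\<lambda>x y. g x y a) ys (i a))) \<le> q (size (eA a))"
  shows "computes b D eA (\<lambda>a. fold (\<lambda>x y. g x y a) (l a) (i a)) eY"
proof -
  from l obtain cl Kl pl where l: "1 \<le> Kl"
    "\<And>a K'. a \<in> D \<Longrightarrow> Kl \<le> K' \<Longrightarrow> clean_run b K' cl (eA a) (enc_list eX (l a)) (poly pl (size (eA a)))"
    "\<And>a. a \<in> D \<Longrightarrow> b \<Longrightarrow> size (enc_list eX (l a)) \<le> poly pl (size (eA a))"
    by (rule computesE) blast
  from computes_pair[OF assms(1) computes_pair[OF assms(2) computes_id]]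
  obtain c K p where init: "1 \<le> K"
    "\<And>a K'. a \<in> D \<Longrightarrow> K \<le> K' \<Longrightarrow> clean_run b K' c (eA a)
      (enc_prod (enc_list eX) (enc_prod eY eA) (l a, i a, a)) (poly p (size (eA a)))"
    by (rule computesE) blast
  from g obtain d L r where g: "1 \<le> L"
    "\<And>z K'. z \<in> E \<Longrightarrow> L \<le> K' \<Longrightarrow> clean_run b K' d (enc_prod eX (enc_prod eY eA) z)
      (eY (g (fst z) (fst (snd z)) (snd (snd z)))) (poly r (size (enc_prod eX (enc_prod eY eA) z)))"
    by (rule computesE) blast
  obtain q' where q': "\<And>x. b \<Longrightarrow> q x \<le> poly q' x" using q unfolding poly_bounded_def by blast
  \<comment> \<open>Bounds the time of one call: its argument is the triple of element, accumulator
    and input, and the two ones are its \<open>Pair\<close> nodes.\<close>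
  let ?M = "\<lambda>x. poly r (poly pl x + (poly q' x + x + 1) + 1)"
  let ?t = "\<lambda>x. poly p x + (poly pl x * (?M x + 12) + 15)"
  let ?K = "max K L"
  show ?thesis
  proof (rule computesI[where K = "?K + 2" and c = "Seq c (fold_com ?K d)" and t = ?t and t' = "poly q'"])
    fix a assume a: "a \<in> D"
    let ?g = "\<lambda>x y. g x y a"
    have "clean_run b (?K + 2) (fold_com ?K d) (Pair (enc_list eX (l a)) (Pair (eY (i a)) (eA a)))
        (eY (fold ?g (l a) (i a))) (length (l a) * (?M (size (eA a)) + 12) + 15)"
    proof (rule clean_run_fold)
      fix ys x zs assume ls: "l a = ys @ x # zs"
      let ?u = "Pair (eX x) (Pair (eY (fold ?g ys (i a))) (eA a))"
      have sz: "size ?u \<le> poly pl (size (eA a)) + (poly q' (size (eA a)) + size (eA a) + 1) + 1" if b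
      proof -
        have "size (eX x) \<le> size (enc_list eX (l a))" using ls by (intro size_le_size_enc_list) auto
        moreover have "size (enc_list eX (l a)) \<le> poly pl (size (eA a))" by (rule l(3)[OF a that])
        moreover have "size (eY (fold ?g ys (i a))) \<le> poly q' (size (eA a))"
          using sz[OF that a ls] q'[OF that] le_trans by blast
        ultimately show ?thesis by simp
      qed
      show "clean_run b ?K d ?u (eY (?g x (fold ?g ys (i a)))) (?M (size (eA a)))"
      proof (rule clean_run_mono)
        show "clean_run b ?K d ?u (eY (?g x (fold ?g ys (i a)))) (poly r (size ?u))"
          using g(2)[OF E[OF a ls], of ?K] by (simp add: enc_prod_def)
        show "poly r (size ?u) \<le> ?M (size (eA a))" if b by (rule poly_nat_mono[OF sz[OF that]])
      qed simp
    qed (use init(1) in auto)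
    then have "clean_run b (?K + 2) (fold_com ?K d) (Pair (enc_list eX (l a)) (Pair (eY (i a)) (eA a)))
        (eY (fold ?g (l a) (i a))) (poly pl (size (eA a)) * (?M (size (eA a)) + 12) + 15)"
      using length_le_size_enc_list[of "l a" eX] l(3)[OF a]
      by (elim clean_run_mono) (auto intro!: mult_right_mono elim: le_trans)
    moreover have "clean_run b (?K + 2) c (eA a) (Pair (enc_list eX (l a)) (Pair (eY (i a)) (eA a)))
       (poly p (size (eA a)))"
      using init(2)[OF a, of "?K + 2"] by (simp add: enc_prod_def)
    ultimately show "clean_run b (?K + 2) (Seq c (fold_com ?K d)) (eA a)
        (eY (fold ?g (l a) (i a))) (?t (size (eA a)))"
      by (intro clean_run_Seq)
    show "size (eY (fold ?g (l a) (i a))) \<le> poly q' (size (eA a))" if b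
      using sz[OF that a, of "l a" "[]"] q'[OF that, of "size (eA a)"] by simp
  qed (intro poly_bounded_intros)+
qed

section \<open>Boolean and list operations\<close>

named_theorems computes_intros
declare computes_id [computes_intros] computes_const [computes_intros] computes_pair [computes_intros]
  computes_fst [computes_intros] computes_snd [computes_intros] computes_if [computes_intros]

text \<open>Short-circuit evaluation: \<open>Q\<close> needs a program only where \<open>P\<close>
  holds. The check of constraints depends on this, since the checker is specified only on plans
  already known to assign every step.\<close>

lemma computes_conj [computes_intros]:
  assumes "computes b D eA P enc_bool" "computes b {a \<in> D. P a} eA Q enc_bool"
  shows "computes b D eA (\<lambda>a. P a \<and> Q a) enc_bool"
  by (rule computes_cong[OF computes_if[OF assms computes_const[where x = False and eB = enc_bool]]]) auto

lemma computes_disj [computes_intros]: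
  assumes "computes b D eA P enc_bool" "computes b {a \<in> D. \<not> P a} eA Q enc_bool"
  shows "computes b D eA (\<lambda>a. P a \<or> Q a) enc_bool"
  by (rule computes_cong[OF computes_if[OF assms(1) computes_const[where x = True and eB = enc_bool] assms(2)]]) auto

lemma computes_not [computes_intros]:
  assumes "computes b D eA P enc_bool"
  shows "computes b D eA (\<lambda>a. \<not> P a) enc_bool"
  by (rule computes_cong[OF computes_if[OF assms computes_const[where x = False and eB = enc_bool]
        computes_const[where x = True and eB = enc_bool]]]) auto

lemma computes_test_Atom:
  assumes f: "computes b D eA f eB" and P: "\<And>y. P y \<longleftrightarrow> eB y \<noteq> Atom"
  shows "computes b D eA (\<lambda>a. P (f a)) enc_bool"
proof (rule computes_comp[OF f, where E = UNIV])
  let ?c = "Cond (EVar 0) (Assign 0 (ECons ENil ENil)) (Assign 0 ENil)"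
  show "computes b UNIV eB P enc_bool"
  proof (rule computesI[where c = ?c and K = 1 and t = "\<lambda>_. 6" and t' = "\<lambda>_. 1"])
    fix y
    have "clean_run b 1 ?c (eB y) (enc_bool (P y)) (exp_cost (EVar 0) + 1 + 4)"
    proof (rule clean_run_Cond)
      assume "eval_exp (EVar 0) (\<lambda>_. eB y) \<noteq> Atom"
      then show "clean_run b 1 (Assign 0 (ECons ENil ENil)) (eB y) (enc_bool (P y)) 4"
        using clean_run_Assign[of "ECons ENil ENil" b 1 "eB y"] P[of y] by (simp add: eval_nat_numeral)
    next
      assume "eval_exp (EVar 0) (\<lambda>_. eB y) = Atom"
      then show "clean_run b 1 (Assign 0 ENil) (eB y) (enc_bool (P y)) 4"
        using clean_run_mono[OF clean_run_Assign[of ENil b 1 "eB y"], of 1 4] P[of y] by simp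
    qed simp
    then show "clean_run b 1 ?c (eB y) (enc_bool (P y)) 6" by simp
  qed (use size_enc_bool in \<open>auto intro!: poly_bounded_intros\<close>)
qed simp

lemma enc_list_eq_Atom: "enc_list e xs = Atom \<longleftrightarrow> xs = []"
  by (cases xs) auto

lemma computes_neq_Nil: "computes b D eA f (enc_list eX) \<Longrightarrow> computes b D eA (\<lambda>a. f a \<noteq> []) enc_bool"
  by (rule computes_test_Atom[where P = "\<lambda>xs. xs \<noteq> []"]) (auto simp: enc_list_eq_Atom)

lemma computes_eq_Nil [computes_intros]:
  "computes b D eA f (enc_list eX) \<Longrightarrow> computes b D eA (\<lambda>a. f a = []) enc_bool"
  by (drule computes_neq_Nil, drule computes_not, simp)

lemma computes_eq_0 [computes_intros]:
  assumes "computes b D eA f enc_nat"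
  shows "computes b D eA (\<lambda>a. f a = 0) enc_bool"
proof -
  have "computes b D eA (\<lambda>a. f a \<noteq> 0) enc_bool"
    by (rule computes_test_Atom[OF assms]) (metis enc_nat.elims enc_nat.simps val.distinct(1))
  from computes_not[OF this] show ?thesis by simp
qed

lemma computes_Suc [computes_intros]:
  assumes "computes b D eA f enc_nat"
  shows "computes b D eA (\<lambda>a. Suc (f a)) enc_nat"
  by (rule computes_comp[OF assms, where E = UNIV],
      rule computes_exp[where e = "ECons ENil (EVar 0)" and t = "\<lambda>x. Suc x"])
    (auto intro!: poly_bounded_intros)

lemma computes_Cons [computes_intros]:
  assumes "computes b D eA f eX" "computes b D eA g (enc_list eX)"
  shows "computes b D eA (\<lambda>a. f a # g a) (enc_list eX)"
  by (rule computes_cong[OF computes_pair[OF assms]]) (auto simp: enc_prod_def)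

lemma computes_tl:
  assumes "computes b D eA f (enc_list eX)"
  shows "computes b D eA (\<lambda>a. tl (f a)) (enc_list eX)"
proof -
  have "enc_list eX (tl xs) = vtl (enc_list eX xs)" for xs by (cases xs) auto
  moreover have "size (enc_list eX (tl xs)) \<le> size (enc_list eX xs)" for xs by (cases xs) auto
  ultimately show ?thesis
    by (intro computes_comp[OF assms, where E = UNIV]
        computes_exp[where e = "ETl (EVar 0)" and t = "\<lambda>x. x"]) (auto intro!: poly_bounded_intros)
qed

lemma computes_hd:
  assumes "computes b D eA f (enc_list eX)" and "\<And>a. a \<in> D \<Longrightarrow> f a \<noteq> []"
  shows "computes b D eA (\<lambda>a. hd (f a)) eX"
proof -
  have "eX (hd xs) = vhd (enc_list eX xs)" "size (eX (hd xs)) \<le> size (enc_list eX xs)"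
    if "xs \<noteq> []" for xs using that by (cases xs; auto)+
  then show ?thesis using assms(2)
    by (intro computes_comp[OF assms(1), where E = "{xs. xs \<noteq> []}"]
        computes_exp[where e = "EHd (EVar 0)" and t = "\<lambda>x. x"]) (auto intro!: poly_bounded_intros)
qed

lemma computes_take_1 [computes_intros]:
  assumes "computes b D eA f (enc_list eX)"
  shows "computes b D eA (\<lambda>a. take 1 (f a)) (enc_list eX)"
proof -
  have "take 1 xs = (if xs = [] then [] else [hd xs])" for xs :: "'b list" by (cases xs) auto
  moreover have "computes b D eA (\<lambda>a. if f a = [] then [] else [hd (f a)]) (enc_list eX)"
    by (intro computes_if computes_eq_Nil[OF assms] computes_const computes_Cons computes_hd
        computes_subset[OF assms]) auto
  ultimately show ?thesis by (simp only:)
qed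

lemma computes_rev:
  assumes "computes b D eA f (enc_list eX)"
  shows "computes b D eA (\<lambda>a. rev (f a)) (enc_list eX)"
proof -
  have rev: "fold (\<lambda>x ys. x # ys) xs ys = rev xs @ ys" for xs ys :: "'b list"
    by (induction xs arbitrary: ys) auto
  have "computes b UNIV (enc_list eX) (\<lambda>a. fold (\<lambda>x ys. x # ys) a []) (enc_list eX)"
    by (rule computes_fold[where E = UNIV and q = "\<lambda>x. x"], (rule computes_intros)+)
      (auto simp: rev size_enc_list rev_map[symmetric] intro: poly_bounded_intros)
  then show ?thesis by (intro computes_comp[OF assms, where E = UNIV]) (auto simp: rev)
qed

text \<open>Folding from the right keeps the order of the results, which suits \<open>map\<close>,
  \<open>filter\<close> and concatenation; the intermediate values then belong to suffixes of the
  list.\<close>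

lemma computes_foldr:
  assumes l: "computes b D eA l (enc_list eX)" and i: "computes b D eA i eY"
    and g: "computes b E (enc_prod eX (enc_prod eY eA)) (\<lambda>p. g (fst p) (fst (snd p)) (snd (snd p))) eY"
    and E: "\<And>a ys x zs. a \<in> D \<Longrightarrow> l a = ys @ x # zs \<Longrightarrow> (x, foldr (\<lambda>x y. g x y a) zs (i a), a) \<in> E"
    and q: "b \<Longrightarrow> poly_bounded q"
    and sz: "\<And>a ys zs. b \<Longrightarrow> a \<in> D \<Longrightarrow> l a = ys @ zs \<Longrightarrow>
       size (eY (foldr (\<lambda>x y. g x y a) zs (i a))) \<le> q (size (eA a))"
  shows "computes b D eA (\<lambda>a. foldr (\<lambda>x y. g x y a) (l a) (i a)) eY"
proof -
  have "computes b D eA (\<lambda>a. fold (\<lambda>x y. g x y a) (rev (l a)) (i a)) eY"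
  proof (rule computes_fold[OF computes_rev[OF l] i g _ q])
    fix a ys x zs assume "a \<in> D" "rev (l a) = ys @ x # zs"
    then show "(x, fold (\<lambda>x y. g x y a) ys (i a), a) \<in> E"
      using E[of a "rev zs" x "rev ys"] by (simp add: rev_swap foldr_conv_fold)
  next
    fix a ys zs assume "b" "a \<in> D" "rev (l a) = ys @ zs"
    then show "size (eY (fold (\<lambda>x y. g x y a) ys (i a))) \<le> q (size (eA a))"
      using sz[of a "rev zs" "rev ys"] by (simp add: rev_swap foldr_conv_fold)
  qed
  then show ?thesis by (simp add: foldr_conv_fold)
qed

text \<open>In unary, a number already is the list of that many nil entries, so bounded iteration is
  a fold and needs no conversion.\<close>

lemma computes_replicate_unit:
  "computes b D eA n enc_nat \<Longrightarrow> computes b D eA (\<lambda>a. replicate (n a) ()) (enc_list (\<lambda>_. Atom))"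
proof (erule computes_cong)
  have "enc_list (\<lambda>_. Atom) (replicate n ()) = enc_nat n" for n by (induction n) auto
  then show "enc_list (\<lambda>_. Atom) (replicate (n a) ()) = enc_nat (n a)" for a .
qed simp

lemma size_enc_nat [simp]: "size (enc_nat n) = n"
  by (induction n) auto

text \<open>The parameter \<open>a\<close> travels beside each element in place of a closure, and
  the domain for \<open>g\<close> remembers that the element comes from the list.\<close>

lemma computes_map [computes_intros]:
  assumes l: "computes b D eA l (enc_list eX)"
    and g: "computes b {p. snd p \<in> D \<and> fst p \<in> set (l (snd p))} (enc_prod eX eA)
      (\<lambda>p. g (fst p) (snd p)) eY"
  shows "computes b D eA (\<lambda>a. map (\<lambda>x. g x a) (l a)) (enc_list eY)"
proof -
  let ?E = "{p. snd p \<in> D \<and> fst p \<in> set (l (snd p))}"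
  let ?E' = "{p. snd (snd p) \<in> D \<and> fst p \<in> set (l (snd (snd p)))}"
  obtain p where p: "\<And>z. z \<in> ?E \<Longrightarrow> b \<Longrightarrow>
      size (eY (g (fst z) (snd z))) \<le> poly p (size (enc_prod eX eA z))"
    using g by (rule computesE) blast
  obtain q where q: "\<And>a. a \<in> D \<Longrightarrow> b \<Longrightarrow> size (enc_list eX (l a)) \<le> poly q (size (eA a))"
    using l by (rule computesE) blast
  have map: "foldr (\<lambda>x ys. g x a # ys) xs [] = map (\<lambda>x. g x a) xs" for xs a by (induction xs) auto
  let ?q = "\<lambda>x. poly q x * Suc (poly p (poly q x + x + 1))"
  have "computes b D eA (\<lambda>a. foldr (\<lambda>x ys. g x a # ys) (l a) []) (enc_list eY)"
  proof (rule computes_foldr[where E = ?E' and q = ?q, OF l computes_const])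
    have sub: "computes b ?E' (enc_prod eX (enc_prod (enc_list eY) eA))
       (\<lambda>p. (fst p, snd (snd p))) (enc_prod eX eA)" by (rule computes_intros)+
    have "computes b ?E' (enc_prod eX (enc_prod (enc_list eY) eA))
       (\<lambda>p. (\<lambda>p. g (fst p) (snd p)) ((fst p, snd (snd p)))) eY"
      by (rule computes_comp[OF sub g]) auto
    then have "computes b ?E' (enc_prod eX (enc_prod (enc_list eY) eA))
       (\<lambda>p. g (fst p) (snd (snd p))) eY" by simp
    then show "computes b ?E' (enc_prod eX (enc_prod (enc_list eY) eA))
        (\<lambda>p. g (fst p) (snd (snd p)) # fst (snd p)) (enc_list eY)"
      by (rule computes_Cons) (rule computes_intros)+
  next
    fix a ys zs assume b: b and a: "a \<in> D" and ls: "l a = ys @ zs"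
    have "length zs \<le> size (enc_list eX (l a))"
      using length_le_size_enc_list[of "l a" eX] ls by simp
    then have len: "length zs \<le> poly q (size (eA a))" using q[OF a b] by simp
    have "size (enc_list eY (map (\<lambda>x. g x a) zs)) \<le> length (map (\<lambda>x. g x a) zs) *
      Suc (poly p (poly q (size (eA a)) + size (eA a) + 1))"
    proof (rule size_enc_list_le)
      fix y assume "y \<in> set (map (\<lambda>x. g x a) zs)"
      then obtain x where x: "x \<in> set zs" "y = g x a" by auto
      then have "size (eX x) \<le> size (enc_list eX (l a))" using ls by (intro size_le_size_enc_list) auto
      then have "size (enc_prod eX eA (x, a)) \<le> poly q (size (eA a)) + size (eA a) + 1"
        using q[OF a b] by (simp add: enc_prod_def)
      moreover have "size (eY (g x a)) \<le> poly p (size (enc_prod eX eA (x, a)))"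
        using p[of "(x, a)"] x a b ls by simp
      ultimately show "size (eY y) \<le> poly p (poly q (size (eA a)) + size (eA a) + 1)"
        using poly_nat_mono le_trans x(2) by blast
    qed
    also have "\<dots> \<le> ?q (size (eA a))" using len by (simp add: mult_right_mono del: mult_Suc_right)
    finally show "size (enc_list eY (foldr (\<lambda>x ys. g x a # ys) zs [])) \<le> ?q (size (eA a))"
      by (simp add: map)
  qed (auto intro!: poly_bounded_intros)
  then show ?thesis by (simp add: map)
qed

lemma computes_filter [computes_intros]:
  assumes l: "computes b D eA l (enc_list eX)"
    and g: "computes b {p. snd p \<in> D \<and> fst p \<in> set (l (snd p))} (enc_prod eX eA)
      (\<lambda>p. P (fst p) (snd p)) enc_bool"
  shows "computes b D eA (\<lambda>a. filter (\<lambda>x. P x a) (l a)) (enc_list eX)"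
proof -
  let ?E' = "{p. snd (snd p) \<in> D \<and> fst p \<in> set (l (snd (snd p)))}"
  obtain q where q: "\<And>a. a \<in> D \<Longrightarrow> b \<Longrightarrow> size (enc_list eX (l a)) \<le> poly q (size (eA a))"
    using l by (rule computesE) blast
  have filter: "foldr (\<lambda>x ys. if P x a then x # ys else ys) xs [] = filter (\<lambda>x. P x a) xs" for xs a
    by (induction xs) auto
  have "computes b D eA (\<lambda>a. foldr (\<lambda>x ys. if P x a then x # ys else ys) (l a) []) (enc_list eX)"
  proof (rule computes_foldr[where E = ?E' and q = "poly q", OF l computes_const])
    have sub: "computes b ?E' (enc_prod eX (enc_prod (enc_list eX) eA))
       (\<lambda>p. (fst p, snd (snd p))) (enc_prod eX eA)" by (rule computes_intros)+
    have "computes b ?E' (enc_prod eX (enc_prod (enc_list eX) eA))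
       (\<lambda>p. (\<lambda>p. P (fst p) (snd p)) ((fst p, snd (snd p)))) enc_bool"
      by (rule computes_comp[OF sub g]) auto
    then have "computes b ?E' (enc_prod eX (enc_prod (enc_list eX) eA))
       (\<lambda>p. P (fst p) (snd (snd p))) enc_bool" by simp
    then show "computes b ?E' (enc_prod eX (enc_prod (enc_list eX) eA))
        (\<lambda>p. if P (fst p) (snd (snd p)) then fst p # fst (snd p) else fst (snd p)) (enc_list eX)"
      by (rule computes_if) (rule computes_intros)+
  next
    fix a ys zs assume b: b and a: "a \<in> D" and ls: "l a = ys @ zs"
    have "size (enc_list eX (filter (\<lambda>x. P x a) zs)) \<le> size (enc_list eX zs)"
      by (induction zs) auto
    also have "\<dots> \<le> size (enc_list eX (l a))" by (simp add: ls size_enc_list)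
    finally show "size (enc_list eX (foldr (\<lambda>x ys. if P x a then x # ys else ys) zs [])) \<le> poly q (size (eA a))"
      using q[OF a b] by (simp add: filter)
  qed (auto intro!: poly_bounded_intros)
  then show ?thesis by (simp add: filter)
qed

lemma computes_list_all [computes_intros]:
  assumes l: "computes b D eA l (enc_list eX)"
    and g: "computes b {p. snd p \<in> D \<and> fst p \<in> set (l (snd p))} (enc_prod eX eA)
      (\<lambda>p. P (fst p) (snd p)) enc_bool"
  shows "computes b D eA (\<lambda>a. list_all (\<lambda>x. P x a) (l a)) enc_bool"
proof -
  have "computes b D eA (\<lambda>a. filter (\<lambda>x. \<not> P x a) (l a) = []) enc_bool"
    by (rule computes_eq_Nil computes_filter[OF l] computes_not g)+
  then show ?thesis by (simp add: filter_empty_conv list_all_iff)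
qed

lemma computes_list_ex [computes_intros]:
  assumes l: "computes b D eA l (enc_list eX)"
    and g: "computes b {p. snd p \<in> D \<and> fst p \<in> set (l (snd p))} (enc_prod eX eA)
      (\<lambda>p. P (fst p) (snd p)) enc_bool"
  shows "computes b D eA (\<lambda>a. list_ex (\<lambda>x. P x a) (l a)) enc_bool"
proof -
  have "computes b D eA (\<lambda>a. \<not> filter (\<lambda>x. P x a) (l a) = []) enc_bool"
    by (rule computes_not computes_eq_Nil computes_filter[OF l] g)+
  then show ?thesis by (simp add: filter_empty_conv list_ex_iff)
qed

lemma computes_append:
  assumes f: "computes b D eA f (enc_list eX)" and g: "computes b D eA g (enc_list eX)"
  shows "computes b D eA (\<lambda>a. f a @ g a) (enc_list eX)"
proof -
  have app: "foldr (\<lambda>x ys. x # ys) xs ys = xs @ ys" for xs ys :: "'b list" by (induction xs) auto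
  have "computes b UNIV (enc_prod (enc_list eX) (enc_list eX))
      (\<lambda>p. foldr (\<lambda>x ys. x # ys) (fst p) (snd p)) (enc_list eX)"
    by (rule computes_foldr[where E = UNIV and q = "\<lambda>x. x"], (rule computes_intros)+)
      (auto simp: app size_enc_list enc_prod_def intro: poly_bounded_intros)
  from computes_comp[OF computes_pair[OF f g] this] show ?thesis by (simp add: app)
qed

lemma computes_concat [computes_intros]:
  assumes f: "computes b D eA f (enc_list (enc_list eX))"
  shows "computes b D eA (\<lambda>a. concat (f a)) (enc_list eX)"
proof -
  have conc: "foldr (\<lambda>xs ys. xs @ ys) xss [] = concat xss" for xss :: "'b list list"
    by (induction xss) auto
  have size: "size (enc_list eX (concat xss)) \<le> size (enc_list (enc_list eX) xss)" for xss
    by (induction xss) (auto simp: size_enc_list)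
  have "computes b UNIV (enc_list (enc_list eX)) (\<lambda>a. foldr (\<lambda>xs ys. xs @ ys) a []) (enc_list eX)"
  proof (rule computes_foldr[where E = UNIV and q = "\<lambda>x. x"])
    fix a ys zs :: "'b list list" assume "a = ys @ zs"
    then have "size (enc_list (enc_list eX) zs) \<le> size (enc_list (enc_list eX) a)"
      by (simp add: size_enc_list)
    then show "size (enc_list eX (foldr (\<lambda>xs ys. xs @ ys) zs [])) \<le> size (enc_list (enc_list eX) a)"
      using size[of zs] by (simp add: conc)
  qed (rule computes_append computes_intros poly_bounded_intros | simp)+
  then show ?thesis by (intro computes_comp[OF f, where E = UNIV]) (auto simp: conc)
qed

section \<open>Unary arithmetic and indexing\<close>

lemma computes_length [computes_intros]:
  assumes f: "computes b D eA f (enc_list eX)"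
  shows "computes b D eA (\<lambda>a. length (f a)) enc_nat"
proof -
  have len: "foldr (\<lambda>x n. Suc n) xs 0 = length xs" for xs :: "'b list" by (induction xs) auto
  have "computes b UNIV (enc_list eX) (\<lambda>a. foldr (\<lambda>x n. Suc n) a 0) enc_nat"
  proof (rule computes_foldr[where E = UNIV and q = "\<lambda>x. x"])
    fix a ys zs :: "'b list" assume "a = ys @ zs"
    then show "size (enc_nat (foldr (\<lambda>x n. Suc n) zs 0)) \<le> size (enc_list eX a)"
      using length_le_size_enc_list[of a eX] by (simp add: len)
  qed (rule computes_intros poly_bounded_intros | simp)+
  then show ?thesis by (intro computes_comp[OF f, where E = UNIV]) (auto simp: len)
qed

lemma computes_pred:
  assumes "computes b D eA f enc_nat"
  shows "computes b D eA (\<lambda>a. f a - Suc 0) enc_nat"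
proof -
  have "enc_nat (n - Suc 0) = vtl (enc_nat n)" for n by (cases n) auto
  moreover have "size (enc_nat (n - Suc 0)) \<le> size (enc_nat n)" for n by simp
  ultimately show ?thesis
    by (intro computes_comp[OF assms, where E = UNIV]
        computes_exp[where e = "ETl (EVar 0)" and t = "\<lambda>x. x"]) (simp_all add: poly_bounded_intros del: size_enc_nat)
qed

lemma computes_minus [computes_intros]:
  assumes f: "computes b D eA f enc_nat" and g: "computes b D eA g enc_nat"
  shows "computes b D eA (\<lambda>a. f a - g a) enc_nat"
proof -
  have minus: "fold (\<lambda>_ y. y - Suc 0) (xs :: unit list) m = m - length xs" for xs m
    by (induction xs arbitrary: m) auto
  have "computes b UNIV (enc_prod enc_nat enc_nat)
      (\<lambda>p. fold (\<lambda>_ y. y - Suc 0) (replicate (snd p) ()) (fst p)) enc_nat"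
    by (rule computes_fold[where E = UNIV and q = "\<lambda>x. x"],
        (rule computes_replicate_unit computes_pred computes_intros poly_bounded_intros | simp)+)
      (auto simp: minus enc_prod_def)
  from computes_comp[OF computes_pair[OF f g] this] show ?thesis by (simp add: minus del: fold_replicate)
qed

lemma computes_less [computes_intros]:
  assumes f: "computes b D eA f enc_nat" and g: "computes b D eA g enc_nat"
  shows "computes b D eA (\<lambda>a. f a < g a) enc_bool"
proof -
  have "computes b D eA (\<lambda>a. \<not> g a - f a = 0) enc_bool" by (intro computes_intros f g)
  then show ?thesis by (simp add: not_le)
qed

lemma computes_eq_nat [computes_intros]:
  assumes f: "computes b D eA f enc_nat" and g: "computes b D eA g enc_nat"
  shows "computes b D eA (\<lambda>a. f a = g a) enc_bool"
proof -
  have "computes b D eA (\<lambda>a. \<not> f a < g a \<and> \<not> g a < f a) enc_bool"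
    by (intro computes_intros computes_subset[OF f] computes_subset[OF g]) auto
  then show ?thesis by (simp add: not_less order_eq_iff conj_commute)
qed

text \<open>Reading past the end of a list yields nil, because head and tail of nil are nil. A
  default encoded as nil therefore takes no test of the range, and this is why the search uses
  \<open>nth_default\<close> with 0, \<open>False\<close> and \<open>[]\<close>.\<close>

lemma computes_nth_default [computes_intros]:
  assumes f: "computes b D eA f (enc_list eX)" and g: "computes b D eA g enc_nat"
    and d: "eX d = Atom"
  shows "computes b D eA (\<lambda>a. nth_default d (f a) (g a)) eX"
proof -
  have drop: "fold (\<lambda>_ y. tl y) us xs = drop (length us) xs" for us :: "unit list" and xs :: "'b list"
    by (induction us arbitrary: xs) (auto simp: drop_Suc tl_drop)
  have "computes b UNIV (enc_prod (enc_list eX) enc_nat)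
      (\<lambda>p. fold (\<lambda>_ y. tl y) (replicate (snd p) ()) (fst p)) (enc_list eX)"
  proof (rule computes_fold[where E = UNIV and q = "\<lambda>x. x"])
    fix a :: "'b list \<times> nat" and us :: "unit list"
    have "size (enc_list eX (drop (length us) (fst a))) \<le> size (enc_list eX (take (length us) (fst a) @ drop (length us) (fst a)))"
      unfolding size_enc_list map_append sum_list_append by simp
    then have "size (enc_list eX (drop (length us) (fst a))) \<le> size (enc_list eX (fst a))" by simp
    then show "size (enc_list eX (fold (\<lambda>_ y. tl y) us (fst a))) \<le> size (enc_prod (enc_list eX) enc_nat a)"
      by (simp add: drop enc_prod_def)
  qed (rule computes_replicate_unit computes_tl computes_intros poly_bounded_intros | simp)+
  from computes_comp[OF computes_pair[OF f g] this]
  have "computes b D eA (\<lambda>a. drop (g a) (f a)) (enc_list eX)"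
    by (simp add: drop del: fold_replicate)
  then have "computes b D eA (\<lambda>a. nth_default d (drop (g a) (f a)) 0) eX"
  proof (rule computes_comp[where E = UNIV])
    show "computes b UNIV (enc_list eX) (\<lambda>a. nth_default d a 0) eX"
    proof (rule computes_exp[where e = "EHd (EVar 0)" and t = "\<lambda>x. x"])
      show "eval_exp (EHd (EVar 0)) (\<lambda>_. enc_list eX a) = eX (nth_default d a 0)" for a
        by (cases a) (auto simp: d)
      show "size (eX (nth_default d a 0)) \<le> size (enc_list eX a)" for a
        by (cases a) (auto simp: d)
    qed (auto intro: poly_bounded_intros)
  qed simp
  moreover have "nth_default d (drop n xs) 0 = nth_default d xs n" for n xs
    by (simp add: nth_default_def)
  ultimately show ?thesis by simp
qed

lemma computes_upt [computes_intros]: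
  assumes f: "computes b D eA f enc_nat"
  shows "computes b D eA (\<lambda>a. [0..<f a]) (enc_list enc_nat)"
proof -
  let ?fold = "\<lambda>us :: unit list. fold (\<lambda>_ p. (Suc (fst p), fst p # snd p)) us (0, [])"
  have upt: "?fold us = (length us, rev [0..<length us])" for us
    by (induction us rule: rev_induct) auto
  let ?q = "\<lambda>n. n + n * Suc n + 1"
  have "computes b UNIV enc_nat (\<lambda>n. ?fold (replicate n ())) (enc_prod enc_nat (enc_list enc_nat))"
  proof (rule computes_fold[where E = UNIV and q = ?q])
    fix n and us vs :: "unit list" assume us: "replicate n () = us @ vs"
    then have l: "length us \<le> n" by (metis length_append length_replicate le_add1)
    have "size (enc_list enc_nat (rev [0..<length us])) \<le> length (rev [0..<length us]) * Suc n"
      by (rule size_enc_list_le) (use l in auto)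
    also have "\<dots> \<le> n * Suc n" using l by (simp del: mult_Suc_right)
    finally show "size (enc_prod enc_nat (enc_list enc_nat) (?fold us)) \<le> ?q (size (enc_nat n))"
      using l by (simp add: upt enc_prod_def)
  qed (rule computes_replicate_unit computes_intros poly_bounded_intros | simp)+
  from computes_rev[OF computes_snd[OF this]]
  have "computes b UNIV enc_nat (\<lambda>n. [0..<n]) (enc_list enc_nat)"
    by (simp add: upt del: fold_replicate)
  then show ?thesis by (intro computes_comp[OF f, where E = UNIV]) auto
qed

lemma computes_replicate:
  assumes f: "computes b D eA n enc_nat" and g: "computes b D eA g eX"
  shows "computes b D eA (\<lambda>a. replicate (n a) (g a)) (enc_list eX)"
proof -
  have "computes b D eA (\<lambda>a. map (\<lambda>_. g a) [0..<n a]) (enc_list eX)"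
  proof (rule computes_map[OF computes_upt[OF f]])
    let ?E = "{p. snd p \<in> D \<and> fst p \<in> set [0..<n (snd p)]}"
    have "computes b ?E (enc_prod enc_nat eA) snd eA"
      using computes_snd[OF computes_id] by simp
    from computes_comp[OF this g]
    show "computes b ?E (enc_prod enc_nat eA) (\<lambda>p. g (snd p)) eX" by auto
  qed
  then show ?thesis by (simp add: map_replicate_const)
qed

section \<open>Arithmetic for the parameter function\<close>

lemma computes_plus:
  assumes f: "computes b D eA f enc_nat" and g: "computes b D eA g enc_nat"
  shows "computes b D eA (\<lambda>a. f a + g a) enc_nat"
proof -
  have plus: "fold (\<lambda>_ y. Suc y) (xs :: unit list) m = length xs + m" for xs m
    by (induction xs arbitrary: m) auto
  have "computes b UNIV (enc_prod enc_nat enc_nat)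
      (\<lambda>p. fold (\<lambda>_ y. Suc y) (replicate (fst p) ()) (snd p)) enc_nat"
  proof (rule computes_fold[where E = UNIV and q = "\<lambda>x. x"])
    fix a :: "nat \<times> nat" and us vs :: "unit list" assume "replicate (fst a) () = us @ vs"
    then have "length us \<le> fst a" by (metis length_append length_replicate le_add1)
    then show "size (enc_nat (fold (\<lambda>_ y. Suc y) us (snd a))) \<le> size (enc_prod enc_nat enc_nat a)"
      by (simp add: plus enc_prod_def)
  qed (rule computes_replicate_unit computes_intros poly_bounded_intros | simp)+
  from computes_comp[OF computes_pair[OF f g] this] show ?thesis by (simp add: plus del: fold_replicate)
qed

lemma computable_mult:
  assumes f: "computes False D eA f enc_nat" and g: "computes False D eA g enc_nat"
  shows "computes False D eA (\<lambda>a. f a * g a) enc_nat"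
proof -
  have mult: "fold (\<lambda>_ y. n + y) (xs :: unit list) m = length xs * n + m" for xs and m n :: nat
    by (induction xs arbitrary: m) auto
  have "computes False UNIV (enc_prod enc_nat enc_nat)
      (\<lambda>p. fold (\<lambda>_ y. snd p + y) (replicate (fst p) ()) 0) enc_nat"
    by (rule computes_fold[where E = UNIV and q = "\<lambda>x. x"])
      (rule computes_replicate_unit computes_plus computes_intros | simp)+
  from computes_comp[OF computes_pair[OF f g] this] show ?thesis by (simp add: mult del: fold_replicate)
qed

text \<open>Stated for \<open>b = False\<close> only, as the unary result may be exponentially long.
  It serves to show that the parameter function is computable.\<close>

lemma computable_power:
  assumes f: "computes False D eA f enc_nat" and g: "computes False D eA g enc_nat"
  shows "computes False D eA (\<lambda>a. f a ^ g a) enc_nat"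
proof -
  have power: "fold (\<lambda>_ y. n * y) (xs :: unit list) m = n ^ length xs * m" for xs and m n :: nat
    by (induction xs arbitrary: m) auto
  have "computes False UNIV (enc_prod enc_nat enc_nat)
      (\<lambda>p. fold (\<lambda>_ y. fst p * y) (replicate (snd p) ()) 1) enc_nat"
    by (rule computes_fold[where E = UNIV and q = "\<lambda>x. x"])
      (rule computes_replicate_unit computable_mult computes_intros | simp)+
  from computes_comp[OF computes_pair[OF f g] this] show ?thesis by (simp add: power del: fold_replicate)
qed

lemma computable2I:
  assumes "computes False UNIV (enc_prod enc_nat enc_nat) (\<lambda>p. f (fst p) (snd p)) enc_nat"
  shows "computable2 f"
proof -
  obtain K c p where c: "\<And>a. clean_run False K c (enc_prod enc_nat enc_nat a)
      (enc_nat (f (fst a) (snd a))) (poly p (size (enc_prod enc_nat enc_nat a)))"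
    using assms by (rule computesE) blast
  have "\<exists>m. runs c (Pair (enc_nat a) (enc_nat b)) (enc_nat (f a b)) m" for a b
    using clean_run_runs[OF c[of "(a, b)"]] by (auto simp: enc_prod_def)
  then show ?thesis unfolding computable2_def by blast
qed

section \<open>The search for a plan\<close>

definition auth_matrix :: "ncwsp \<Rightarrow> bool list list" where
  "auth_matrix I = map (\<lambda>u. map (\<lambda>i. i \<in> auths I u) [0..<num_steps I]) [0..<num_users I]"

definition level_matrices :: "ncwsp \<Rightarrow> bool list list list" where
  "level_matrices I =
     map (\<lambda>R. map (\<lambda>u. map (\<lambda>v. (u, v) \<in> R) [0..<num_users I]) [0..<num_users I]) (levels I)"

text \<open>A scope is encoded relative to the number of steps, but the encoder passed to
  \<open>enc_list\<close> sees one entry at a time; hence each constraint carries this number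
  along.\<close>

type_synonym coded_constraint = "nat \<times> (nat, nat) wconstraint \<times> val"

definition coded_constraints :: "ncwsp \<Rightarrow> coded_constraint list list" where
  "coded_constraints I = map (map (\<lambda>c. (num_steps I, c))) (level_constraints I)"

definition enc_coded_constraint :: "coded_constraint \<Rightarrow> val" where
  "enc_coded_constraint kc = enc_constraint (fst kc) (snd kc)"

lemma enc_list_map: "enc_list e (map f xs) = enc_list (\<lambda>x. e (f x)) xs"
  by (induction xs) auto

text \<open>The two trees coincide exactly, so the components of an instance are reached by
  projections alone.\<close>

lemma enc_ncwsp_eq:
  "enc_ncwsp I =
     enc_prod enc_nat (enc_prod enc_nat (enc_prod (enc_list (enc_list enc_bool))
       (enc_prod (enc_list (enc_list (enc_list enc_bool))) (enc_list (enc_list enc_coded_constraint)))))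
       (num_steps I, num_users I, auth_matrix I, level_matrices I, coded_constraints I)"
proof -
  have "enc_list (enc_list (enc_constraint k)) css =
      enc_list (enc_list enc_coded_constraint) (map (map (\<lambda>c. (k, c))) css)" for k css
    by (simp add: enc_list_map enc_coded_constraint_def[abs_def])
  moreover have "enc_set m X = enc_list enc_bool (map (\<lambda>i. i \<in> X) [0..<m])" for m X
    by (simp add: enc_list_map enc_set_def)
  ultimately show ?thesis
    by (simp add: enc_ncwsp_def enc_prod_def auth_matrix_def level_matrices_def coded_constraints_def
        enc_list_map enc_rel_def[abs_def] Let_def)
qed

section \<open>Access to the components of an instance\<close>

lemma computes_instance:
  assumes "computes b D eA f enc_ncwsp"
  shows "computes b D eA
    (\<lambda>a. (num_steps (f a), num_users (f a), auth_matrix (f a), level_matrices (f a), coded_constraints (f a)))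
    (enc_prod enc_nat (enc_prod enc_nat (enc_prod (enc_list (enc_list enc_bool))
       (enc_prod (enc_list (enc_list (enc_list enc_bool))) (enc_list (enc_list enc_coded_constraint))))))"
  by (rule computes_cong[OF assms]) (auto simp: enc_ncwsp_eq)

lemma computes_num_steps [computes_intros]:
  "computes b D eA f enc_ncwsp \<Longrightarrow> computes b D eA (\<lambda>a. num_steps (f a)) enc_nat"
  by (drule computes_instance, drule computes_fst, simp)

lemma computes_num_users [computes_intros]:
  "computes b D eA f enc_ncwsp \<Longrightarrow> computes b D eA (\<lambda>a. num_users (f a)) enc_nat"
  by (drule computes_instance, drule computes_snd, drule computes_fst, simp)

lemma computes_auth_matrix [computes_intros]:
  "computes b D eA f enc_ncwsp \<Longrightarrow>
    computes b D eA (\<lambda>a. auth_matrix (f a)) (enc_list (enc_list enc_bool))"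
  by (drule computes_instance, drule computes_snd, drule computes_snd, drule computes_fst, simp)

lemma computes_level_matrices [computes_intros]:
  "computes b D eA f enc_ncwsp \<Longrightarrow>
    computes b D eA (\<lambda>a. level_matrices (f a)) (enc_list (enc_list (enc_list enc_bool)))"
  by (drule computes_instance, drule computes_snd, drule computes_snd, drule computes_snd,
      drule computes_fst, simp)

lemma computes_coded_constraints [computes_intros]:
  "computes b D eA f enc_ncwsp \<Longrightarrow>
    computes b D eA (\<lambda>a. coded_constraints (f a)) (enc_list (enc_list enc_coded_constraint))"
  by (drule computes_instance, drule computes_snd, drule computes_snd, drule computes_snd,
      drule computes_snd, simp)

lemma computes_num_levels [computes_intros]:
  assumes "computes b D eA f enc_ncwsp"
  shows "computes b D eA (\<lambda>a. num_levels (f a)) enc_nat"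
  using computes_length[OF computes_level_matrices[OF assms]]
  by (simp add: num_levels_def level_matrices_def)

text \<open>Positions count from 1: in a key, 0 is left to stand for an entry beyond the last level.\<close>

definition first_true :: "bool list \<Rightarrow> nat" where
  "first_true bs = foldr (\<lambda>b m. if b then 1 else Suc m) bs 0"

text \<open>The leading 0 makes all users agree below level 0.\<close>

definition user_key :: "ncwsp \<Rightarrow> nat \<Rightarrow> nat list" where
  "user_key I u = 0 # map (\<lambda>M. first_true (nth_default [] M u)) (level_matrices I)"

text \<open>For users with keys \<open>K\<close> and \<open>K'\<close>: they are equivalent exactly on the levels below \<open>l\<close>, and
  the first one precedes the second in the lexicographic order, or they are equal if \<open>l = r\<close>.\<close>

definition key_step :: "nat list \<Rightarrow> nat list \<Rightarrow> nat \<Rightarrow> bool" where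
  "key_step K K' l \<longleftrightarrow> nth_default 0 K l = nth_default 0 K' l \<and>
     (nth_default 0 K (Suc l) < nth_default 0 K' (Suc l) \<or> nth_default 0 K' (Suc l) = 0)"

type_synonym partial_plan = "nat list \<times> (nat \<times> nat) list"

text \<open>Later steps see a partial plan only through the key of its last user. So one predecessor
  per user is as good as all of them, and \<open>take 1\<close> keeps the table at no more than one
  entry per user.\<close>

definition extend_plans :: "ncwsp \<Rightarrow> nat \<times> nat \<Rightarrow> partial_plan list \<Rightarrow> partial_plan list" where
  "extend_plans I d X = concat (map (\<lambda>u.
     if nth_default False (nth_default [] (auth_matrix I) u) (fst d)
     then map (\<lambda>e. (user_key I u, (fst d, u) # snd e))
       (take 1 (filter (\<lambda>e. key_step (fst e) (user_key I u) (snd d)) X))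
     else []) [0..<num_users I])"

text \<open>The initial empty key reads as 0 everywhere and acts as a virtual user before all
  others: a real key has entries of at least 1 for all levels, so \<open>key_step\<close> with
  number 0 admits every first user.\<close>

definition code_plans :: "ncwsp \<Rightarrow> (nat \<times> nat) list \<Rightarrow> partial_plan list" where
  "code_plans I code = fold (\<lambda>d X. extend_plans I d X) code [([], [])]"

definition lookup :: "(nat \<times> nat) list \<Rightarrow> nat \<Rightarrow> nat" where
  "lookup al s = foldr (\<lambda>p y. if fst p = s then snd p else y) al 0"

definition plan_list :: "nat \<Rightarrow> (nat \<times> nat) list \<Rightarrow> nat list" where
  "plan_list k al = map (\<lambda>s. lookup al s) [0..<k]"

text \<open>The argument is arranged so that its encoding is the very input expected by the
  checker.\<close>

definition satisfied :: "nat \<times> coded_constraint \<times> nat list \<Rightarrow> bool" where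
  "satisfied = (\<lambda>(n, (k, c, d), pl). satisfies (\<lambda>s\<in>{..<k}. pl ! s) c)"

text \<open>A code may repeat steps and so miss others. Coverage is tested before any constraint, so
  that the checker is called only on lists that come from plans.\<close>

definition accepts :: "ncwsp \<Rightarrow> (nat \<times> nat) list \<Rightarrow> bool" where
  "accepts I al \<longleftrightarrow> list_all (\<lambda>s. list_ex (\<lambda>p. fst p = s) al) [0..<num_steps I] \<and>
     list_all (\<lambda>cs. list_all (\<lambda>c. satisfied (num_users I, c, plan_list (num_steps I) al)) cs)
       (coded_constraints I)"

text \<open>The table may hold one plan for each last user. Testing all of them costs only a
  polynomial factor.\<close>

definition accepts_code :: "ncwsp \<Rightarrow> (nat \<times> nat) list \<Rightarrow> bool" where
  "accepts_code I code \<longleftrightarrow> list_ex (\<lambda>e. accepts I (snd e)) (code_plans I code)"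

section \<open>Testing one code takes polynomial time\<close>

lemma computes_first_true [computes_intros]:
  assumes f: "computes b D eA f (enc_list enc_bool)"
  shows "computes b D eA (\<lambda>a. first_true (f a)) enc_nat"
proof -
  have bound: "foldr (\<lambda>b m. if b then 1 else Suc m) bs 0 \<le> length bs" for bs
    by (induction bs) auto
  have "computes b UNIV (enc_list enc_bool) (\<lambda>a. foldr (\<lambda>b m. if b then 1 else Suc m) a 0) enc_nat"
  proof (rule computes_foldr[where E = UNIV and q = "\<lambda>x. x"])
    fix a ys zs :: "bool list" assume "a = ys @ zs"
    then have "length zs \<le> size (enc_list enc_bool a)"
      using length_le_size_enc_list[of a enc_bool] by simp
    then show "size (enc_nat (foldr (\<lambda>b m. if b then 1 else Suc m) zs 0)) \<le> size (enc_list enc_bool a)"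
      using bound[of zs] by simp
  qed (rule computes_intros poly_bounded_intros | simp)+
  then show ?thesis unfolding first_true_def by (intro computes_comp[OF f, where E = UNIV]) auto
qed

lemma computes_user_key [computes_intros]:
  assumes f: "computes b D eA f enc_ncwsp" and g: "computes b D eA g enc_nat"
  shows "computes b D eA (\<lambda>a. user_key (f a) (g a)) (enc_list enc_nat)"
proof -
  \<comment> \<open>Shown for projections as arguments and then composed, so that the rule applies
    to arbitrary argument functions.\<close>
  have "computes b UNIV (enc_prod enc_ncwsp enc_nat) (\<lambda>p. user_key (fst p) (snd p)) (enc_list enc_nat)"
    unfolding user_key_def by (rule computes_intros | simp)+
  from computes_comp[OF computes_pair[OF f g] this] show ?thesis by simp
qed

lemma computes_key_step [computes_intros]:
  assumes f: "computes b D eA f (enc_list enc_nat)" and g: "computes b D eA g (enc_list enc_nat)"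
    and h: "computes b D eA h enc_nat"
  shows "computes b D eA (\<lambda>a. key_step (f a) (g a) (h a)) enc_bool"
proof -
  have "computes b UNIV (enc_prod (enc_list enc_nat) (enc_prod (enc_list enc_nat) enc_nat))
    (\<lambda>p. key_step (fst p) (fst (snd p)) (snd (snd p))) enc_bool"
    unfolding key_step_def by (rule computes_intros | simp)+
  from computes_comp[OF computes_pair[OF f computes_pair[OF g h]] this] show ?thesis by simp
qed

abbreviation enc_code :: "(nat \<times> nat) list \<Rightarrow> val" where
  "enc_code \<equiv> enc_list (enc_prod enc_nat enc_nat)"

abbreviation enc_partial_plan :: "partial_plan \<Rightarrow> val" where
  "enc_partial_plan \<equiv> enc_prod (enc_list enc_nat) enc_code"

lemma computes_extend_plans [computes_intros]:
  assumes f: "computes b D eA f enc_ncwsp" and g: "computes b D eA g (enc_prod enc_nat enc_nat)"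
    and h: "computes b D eA h (enc_list enc_partial_plan)"
  shows "computes b D eA (\<lambda>a. extend_plans (f a) (g a) (h a)) (enc_list enc_partial_plan)"
proof -
  have "computes b UNIV (enc_prod enc_ncwsp (enc_prod (enc_prod enc_nat enc_nat) (enc_list enc_partial_plan)))
    (\<lambda>p. extend_plans (fst p) (fst (snd p)) (snd (snd p))) (enc_list enc_partial_plan)"
    unfolding extend_plans_def by (rule computes_intros | simp)+
  from computes_comp[OF computes_pair[OF f computes_pair[OF g h]] this] show ?thesis by simp
qed

lemma length_concat_map_le:
  "(\<And>x. x \<in> set xs \<Longrightarrow> length (f x) \<le> 1) \<Longrightarrow> length (concat (map f xs)) \<le> length xs"
  by (induction xs) (auto, fastforce)

lemma length_extend_plans: "length (extend_plans I d X) \<le> num_users I"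
  unfolding extend_plans_def by (rule le_trans[OF length_concat_map_le]) auto

lemma set_extend_plansE:
  assumes "e \<in> set (extend_plans I d X)"
  obtains u e' where "u < num_users I" "e' \<in> set X" "e = (user_key I u, (fst d, u) # snd e')"
    "key_step (fst e') (user_key I u) (snd d)"
    "nth_default False (nth_default [] (auth_matrix I) u) (fst d)"
  using assms unfolding extend_plans_def
  by (auto split: if_splits dest!: in_set_takeD)

text \<open>Feeds the size bound of the table, which is proved for arbitrary \<open>I\<close>, not
  just for instances that fulfil the promise.\<close>

lemma code_plans_shape:
  assumes "e \<in> set (code_plans I code)"
  shows "(fst e = [] \<or> (\<exists>u<num_users I. fst e = user_key I u)) \<and> length (snd e) = length code \<and>
    (\<forall>p\<in>set (snd e). fst p \<in> fst ` set code \<and> snd p < num_users I)"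
  using assms
proof (induction code arbitrary: e rule: rev_induct)
  case Nil
  then show ?case by (simp add: code_plans_def)
next
  case (snoc d code)
  then have "e \<in> set (extend_plans I d (code_plans I code))" by (simp add: code_plans_def)
  then obtain u e' where "u < num_users I" "e' \<in> set (code_plans I code)"
    "e = (user_key I u, (fst d, u) # snd e')" by (rule set_extend_plansE)
  then show ?case using snoc.IH[of e'] by auto
qed

text \<open>The successor covers the empty code, whose table holds the initial entry even if there
  are no users.\<close>

lemma length_code_plans: "length (code_plans I code) \<le> Suc (num_users I)"
  by (cases code rule: rev_cases) (auto simp: code_plans_def intro: le_SucI length_extend_plans)

lemma computes_code_plans [computes_intros]:
  assumes f: "computes b D eA f enc_ncwsp" and g: "computes b D eA g enc_code"
  shows "computes b D eA (\<lambda>a. code_plans (f a) (g a)) (enc_list enc_partial_plan)"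
proof -
  \<comment> \<open>The size clause of this fact serves as the bound on the size of keys.\<close>
  have "computes b UNIV (enc_prod enc_ncwsp enc_nat) (\<lambda>p. user_key (fst p) (snd p)) (enc_list enc_nat)"
    by (rule computes_intros)+
  then obtain pk where pk: "\<And>p. b \<Longrightarrow>
      size (enc_list enc_nat (user_key (fst p) (snd p))) \<le> poly pk (size (enc_prod enc_ncwsp enc_nat p))"
    by (rule computesE) blast
  \<comment> \<open>Size of a table entry for input size \<open>A\<close>: a key, computed from an
    instance and a user of joint size at most \<open>2 * A + 1\<close>, then at most
    \<open>A\<close> pairs of numbers up to \<open>A\<close>, and one \<open>Pair\<close>
    node.\<close>
  let ?B = "\<lambda>A. poly pk (2 * A + 1) + A * Suc (2 * A + 1) + 1"
  let ?q = "\<lambda>A. Suc A * Suc (?B A)"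
  have "computes b UNIV (enc_prod enc_ncwsp enc_code)
    (\<lambda>a. fold (\<lambda>d X. extend_plans (fst a) d X) (snd a) [([], [])]) (enc_list enc_partial_plan)"
  proof (rule computes_fold[where E = UNIV and q = ?q])
    fix a :: "ncwsp \<times> (nat \<times> nat) list" and ys zs
    assume b: b and ys: "snd a = ys @ zs"
    obtain I code where a: "a = (I, code)" by (cases a)
    let ?A = "size (enc_prod enc_ncwsp enc_code a)"
    have n: "num_users I \<le> ?A" by (simp add: a enc_prod_def enc_ncwsp_eq)
    have code: "size (enc_code code) \<le> ?A" by (simp add: a enc_prod_def)
    have I: "size (enc_ncwsp I) \<le> ?A" by (simp add: a enc_prod_def)
    have elem: "fst p \<le> ?A" if "p \<in> set code" for p
      using size_le_size_enc_list[OF that, of "enc_prod enc_nat enc_nat"] code by (simp add: enc_prod_def)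
    have "size (enc_partial_plan e) \<le> ?B ?A" if e: "e \<in> set (code_plans I ys)" for e
    proof -
      note shape = code_plans_shape[OF e]
      have key: "size (enc_list enc_nat (fst e)) \<le> poly pk (2 * ?A + 1)"
      proof (cases "fst e = []")
        case False
        then obtain u where u: "u < num_users I" "fst e = user_key I u" using shape by blast
        have "size (enc_list enc_nat (user_key I u)) \<le> poly pk (size (enc_prod enc_ncwsp enc_nat (I, u)))"
          using pk[OF b, of "(I, u)"] by simp
        also have "\<dots> \<le> poly pk (2 * ?A + 1)"
          by (rule poly_nat_mono) (use u(1) n I in \<open>simp add: enc_prod_def\<close>)
        finally show ?thesis by (simp add: u(2))
      qed simp
      have "size (enc_code (snd e)) \<le> length (snd e) * Suc (2 * ?A + 1)"
      proof (rule size_enc_list_le)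
        fix p assume "p \<in> set (snd e)"
        then obtain d where d: "d \<in> set ys" "fst p = fst d" and u: "snd p < num_users I"
          using shape by auto
        have "fst d \<le> ?A" by (rule elem) (use d(1) ys a in auto)
        then have "fst p \<le> ?A" "snd p \<le> ?A" using d(2) u n by auto
        then show "size (enc_prod enc_nat enc_nat p) \<le> 2 * ?A + 1" by (simp add: enc_prod_def)
      qed
      also have "length (snd e) \<le> ?A"
        using shape ys a code length_le_size_enc_list[of code "enc_prod enc_nat enc_nat"] by simp
      then have "length (snd e) * Suc (2 * ?A + 1) \<le> ?A * Suc (2 * ?A + 1)" by (rule mult_right_mono) simp
      finally have "size (enc_code (snd e)) \<le> ?A * Suc (2 * ?A + 1)" .
      then show ?thesis using key by (simp add: enc_prod_def[of "enc_list enc_nat" enc_code e])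
    qed
    then have "size (enc_list enc_partial_plan (code_plans I ys)) \<le> length (code_plans I ys) * Suc (?B ?A)"
      by (rule size_enc_list_le)
    also have "\<dots> \<le> ?q ?A"
      by (rule mult_right_mono) (use length_code_plans[of I ys] n in linarith, simp)
    finally show "size (enc_list enc_partial_plan (fold (\<lambda>d X. extend_plans (fst a) d X) ys [([], [])])) \<le> ?q ?A"
      by (simp only: code_plans_def a fst_conv)
  qed (rule computes_intros poly_bounded_intros | simp del: mult_Suc mult_Suc_right)+
  from computes_comp[OF computes_pair[OF f g] this] show ?thesis by (simp add: code_plans_def)
qed

lemma lookup_in: "s \<in> fst ` set al \<Longrightarrow> (s, lookup al s) \<in> set al"
  by (induction al) (auto simp: lookup_def)

lemma lookup_le: "lookup al s \<le> size (enc_code al)"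
  by (induction al) (auto simp: lookup_def enc_prod_def)

lemma computes_lookup [computes_intros]:
  assumes f: "computes b D eA f enc_code" and g: "computes b D eA g enc_nat"
  shows "computes b D eA (\<lambda>a. lookup (f a) (g a)) enc_nat"
proof -
  have "computes b UNIV (enc_prod enc_code enc_nat)
     (\<lambda>a. foldr (\<lambda>p y. if fst p = snd a then snd p else y) (fst a) 0) enc_nat"
  proof (rule computes_foldr[where E = UNIV and q = "\<lambda>x. x"])
    fix a :: "(nat \<times> nat) list \<times> nat" and ys zs assume "fst a = ys @ zs"
    then have "size (enc_code zs) \<le> size (enc_code (fst a))" by (simp add: size_enc_list)
    then show "size (enc_nat (foldr (\<lambda>p y. if fst p = snd a then snd p else y) zs 0))
      \<le> size (enc_prod enc_code enc_nat a)"
      using lookup_le[of zs "snd a"] by (simp add: lookup_def enc_prod_def)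
  qed (rule computes_intros poly_bounded_intros | simp)+
  from computes_comp[OF computes_pair[OF f g] this] show ?thesis by (simp add: lookup_def)
qed

lemma computes_plan_list [computes_intros]:
  assumes f: "computes b D eA f enc_nat" and g: "computes b D eA g enc_code"
  shows "computes b D eA (\<lambda>a. plan_list (f a) (g a)) (enc_list enc_nat)"
proof -
  have "computes b UNIV (enc_prod enc_nat enc_code) (\<lambda>p. plan_list (fst p) (snd p)) (enc_list enc_nat)"
    unfolding plan_list_def by (rule computes_intros | simp)+
  from computes_comp[OF computes_pair[OF f g] this] show ?thesis by simp
qed

definition check_domain :: "representation \<Rightarrow> (nat \<times> coded_constraint \<times> nat list) set" where
  "check_domain rep = {(n, (k, c, d), pl).
     k \<le> n \<and> wf_constraint {..<k} {..<n} c \<and> rep n c d \<and> length pl = k \<and> set pl \<subseteq> {..<n}}"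

text \<open>The checker is timed in \<open>n\<close>; as \<open>n\<close> is part of its input in
  unary, this is polynomial in the size of the input too.\<close>

lemma computes_satisfied:
  assumes "poly_time_checkable rep"
  shows "computes True (check_domain rep)
    (enc_prod enc_nat (enc_prod enc_coded_constraint (enc_list enc_nat))) satisfied enc_bool"
    (is "computes True ?D ?enc _ _")
proof -
  obtain chk and p :: "nat poly" where *: "\<forall>k n c d.
      k \<le> n \<and> wf_constraint {..<k} {..<n} c \<and> rep n c d \<longrightarrow>
      (\<forall>\<pi> \<in> {..<k} \<rightarrow>\<^sub>E {..<n}. \<exists>m.
         runs chk (Pair (enc_nat n) (Pair (enc_constraint k (c, d)) (enc_plan k \<pi>)))
           (enc_bool (satisfies \<pi> c)) m \<and> m \<le> poly p n)"
    using assms unfolding poly_time_checkable_def by (elim exE)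
  have chk: "\<exists>m. runs chk (Pair (enc_nat n) (Pair (enc_constraint k (c, d)) (enc_plan k \<pi>)))
        (enc_bool (satisfies \<pi> c)) m \<and> m \<le> poly p n"
    if "k \<le> n" "wf_constraint {..<k} {..<n} c" "rep n c d" "\<pi> \<in> {..<k} \<rightarrow>\<^sub>E {..<n}" for k n c d \<pi>
    using *[rule_format, of k n c d \<pi>] that by blast
  obtain chk' K C where chk': "\<And>u v m. runs chk u v m \<Longrightarrow> clean_run True K chk' u v (m + C)"
    using runs_clean_run by blast
  show ?thesis
  proof (rule computesI[where t = "\<lambda>x. poly p x + C" and t' = "\<lambda>_. 1"])
    fix a assume a: "a \<in> ?D"
    obtain n k c d pl where eq: "a = (n, (k, c, d), pl)" by (metis prod.collapse)
    let ?\<pi> = "\<lambda>s\<in>{..<k}. pl ! s"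
    have pl: "length pl = k" "set pl \<subseteq> {..<n}" using a eq by (auto simp: check_domain_def)
    then have "?\<pi> \<in> {..<k} \<rightarrow>\<^sub>E {..<n}" by (auto dest!: nth_mem)
    then obtain m where m: "runs chk (Pair (enc_nat n) (Pair (enc_constraint k (c, d)) (enc_plan k ?\<pi>)))
             (enc_bool (satisfies ?\<pi> c)) m" "m \<le> poly p n"
      using chk[of k n c d ?\<pi>] a eq by (auto simp: check_domain_def)
    have "enc_plan k ?\<pi> = enc_list enc_nat (map (\<lambda>s. ?\<pi> s) [0..<k])"
      by (simp add: enc_plan_def enc_list_map)
    also have "map (\<lambda>s. ?\<pi> s) [0..<k] = pl" using pl(1) by (intro nth_equalityI) auto
    finally have "Pair (enc_nat n) (Pair (enc_constraint k (c, d)) (enc_plan k ?\<pi>)) = ?enc a"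
      by (simp only: fst_conv snd_conv eq enc_prod_def enc_coded_constraint_def)
    moreover have "satisfies ?\<pi> c = satisfied a" by (simp add: eq satisfied_def)
    ultimately have "clean_run True K chk' (?enc a) (enc_bool (satisfied a)) (m + C)"
      using chk'[OF m(1)] by simp
    moreover have "poly p n \<le> poly p (size (?enc a))" by (rule poly_nat_mono) (simp add: eq enc_prod_def)
    ultimately show "clean_run True K chk' (?enc a) (enc_bool (satisfied a)) (poly p (size (?enc a)) + C)"
      using m(2) by (elim clean_run_mono) auto
  qed (use size_enc_bool in \<open>auto intro!: poly_bounded_intros\<close>)
qed

lemma constraintsD:
  assumes I: "ncwsp_instance rep I" and q: "q < num_levels I"
    and cd: "(c, d) \<in> set (level_constraints I ! q)"
  shows "wf_constraint {..<num_steps I} {..<num_users I} c" "rep (num_users I) c d"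
    "class_independent {..<num_users I} (levels I ! q) c"
proof -
  have "c \<in> constraints (workflow_of I)"
    using q cd by (force simp: workflow_of_def)
  then have "wf_constraint (steps (workflow_of I)) (users (workflow_of I)) c"
    using I unfolding ncwsp_instance_def wf_workflow_def Let_def by blast
  then show "wf_constraint {..<num_steps I} {..<num_users I} c" by (simp add: workflow_of_def)
  have "\<forall>(c, d) \<in> set (level_constraints I ! q).
      class_independent {..<num_users I} (levels I ! q) c \<and> rep (num_users I) c d"
    using I q unfolding ncwsp_instance_def Let_def by blast
  then show "rep (num_users I) c d" "class_independent {..<num_users I} (levels I ! q) c"
    using cd by auto
qed

lemma num_steps_le: "ncwsp_instance rep I \<Longrightarrow> num_steps I \<le> num_users I"
  unfolding ncwsp_instance_def wf_workflow_def workflow_of_def Let_def by simp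

lemma length_level_constraints: "ncwsp_instance rep I \<Longrightarrow> length (level_constraints I) = num_levels I"
  unfolding ncwsp_instance_def Let_def by simp

lemma computes_accepts_code:
  assumes rep: "poly_time_checkable rep"
  shows "computes True {p. ncwsp_instance rep (snd p)} (enc_prod enc_code enc_ncwsp)
    (\<lambda>p. accepts_code (snd p) (fst p)) enc_bool"
proof -
  \<comment> \<open>Outside \<open>check_domain\<close> nothing is known about the checker, so each
    of its calls is shown to stay inside.\<close>
  have dom: "(num_users I, c, plan_list (num_steps I) (snd e)) \<in>
     check_domain rep"
    if I: "ncwsp_instance rep I" and e: "e \<in> set (code_plans I code)"
      and al: "list_all (\<lambda>s. list_ex (\<lambda>p. fst p = s) (snd e)) [0..<num_steps I]"
      and c: "cs \<in> set (coded_constraints I)" "c \<in> set cs" for I code e cs c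
  proof -
    obtain q where q: "q < num_levels I" "cs = map (\<lambda>c. (num_steps I, c)) (level_constraints I ! q)"
      using c(1) length_level_constraints[OF I] by (auto simp: coded_constraints_def in_set_conv_nth)
    then obtain c' d where "c = (num_steps I, c', d)" "(c', d) \<in> set (level_constraints I ! q)"
      using c(2) by auto
    moreover have "lookup (snd e) s < num_users I" if "s < num_steps I" for s
    proof -
      have "s \<in> fst ` set (snd e)" using al that by (force simp: list_all_iff list_ex_iff)
      from lookup_in[OF this] code_plans_shape[OF e] show ?thesis by auto
    qed
    ultimately show ?thesis
      using constraintsD(1,2)[OF I q(1)] num_steps_le[OF I]
      by (auto simp: plan_list_def check_domain_def)
  qed
  show ?thesis
    unfolding accepts_code_def accepts_def
    by (rule computes_intros computes_comp[where g = satisfied, OF _ computes_satisfied[OF rep]])+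
      (use dom in \<open>clarsimp; blast\<close>)
qed

section \<open>Correctness of the search\<close>

text \<open>The complements of \<open>B\<close> and of its image are equally large, and any
  bijection between them completes \<open>f\<close>.\<close>

lemma finite_inj_on_extends_bij:
  assumes "finite A" "B \<subseteq> A" "f ` B \<subseteq> A" "inj_on f B"
  obtains g where "bij_betw g A A" "\<And>x. x \<in> B \<Longrightarrow> g x = f x"
proof -
  have fin: "finite B" "finite (f ` B)" using assms finite_subset by blast+
  have "card (A - B) = card (A - f ` B)"
    using assms fin by (simp add: card_Diff_subset card_image)
  then obtain h where h: "bij_betw h (A - B) (A - f ` B)"
    using finite_same_card_bij[of "A - B" "A - f ` B"] assms(1) by auto
  let ?g = "\<lambda>x. if x \<in> B then f x else h x"
  have "bij_betw ?g B (f ` B)"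
    using assms(4) by (subst bij_betw_cong[where g = f]) (auto simp: bij_betw_def)
  moreover have "bij_betw ?g (A - B) (A - f ` B)"
    using h by (subst bij_betw_cong[where g = h]) auto
  ultimately have "bij_betw ?g (B \<union> (A - B)) (f ` B \<union> (A - f ` B))"
    by (rule bij_betw_combine) auto
  moreover have "B \<union> (A - B) = A" "f ` B \<union> (A - f ` B) = A" using assms by auto
  ultimately have "bij_betw ?g A A" by simp
  then show thesis by (rule that) simp
qed

text \<open>Equal patterns make the passage from the classes used by \<pi> to those used by \<pi>' a
  well-defined injection. Extended to a permutation of all classes, it moves the class map of \<pi>
  to that of \<pi>' by condition (2), and condition (1) returns from class maps to plans.\<close>

lemma class_independent_same_pattern:
  assumes fin: "finite U" and eq: "equiv U R" and ci: "class_independent U R c"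
    and wf: "wf_constraint S U c" and \<pi>: "\<pi> \<in> S \<rightarrow> U" and \<pi>': "\<pi>' \<in> S \<rightarrow> U"
    and pat: "\<And>s t. s \<in> S \<Longrightarrow> t \<in> S \<Longrightarrow> (\<pi> s, \<pi> t) \<in> R \<longleftrightarrow> (\<pi>' s, \<pi>' t) \<in> R"
    and sat: "satisfies \<pi> c"
  shows "satisfies \<pi>' c"
proof -
  obtain T \<Theta> where c: "c = (T, \<Theta>)" by (cases c)
  have T: "T \<subseteq> S" and \<theta>: "restrict \<pi> T \<in> \<Theta>"
    using wf sat by (auto simp: c wf_constraint_def satisfies_def)
  have U: "\<pi> s \<in> U" "\<pi>' s \<in> U" if "s \<in> T" for s using that T \<pi> \<pi>' by auto
  have class_eq: "R `` {\<pi> s} = R `` {\<pi> t} \<longleftrightarrow> R `` {\<pi>' s} = R `` {\<pi>' t}"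
    if "s \<in> T" "t \<in> T" for s t
    using pat[of s t] subsetD[OF T] that eq_equiv_class_iff[OF eq] U by simp
  \<comment> \<open>\<open>SOME\<close> picks a step whose user lies in the class \<open>X\<close>;
    by \<open>class_eq\<close> the choice does not affect the class of its user under
    \<pi>'.\<close>
  define f where "f X = R `` {\<pi>' (SOME s. s \<in> T \<and> R `` {\<pi> s} = X)}" for X
  have f: "f (R `` {\<pi> s}) = R `` {\<pi>' s}" if "s \<in> T" for s
  proof -
    let ?t = "SOME t. t \<in> T \<and> R `` {\<pi> t} = R `` {\<pi> s}"
    have "?t \<in> T \<and> R `` {\<pi> ?t} = R `` {\<pi> s}" by (rule someI) (use that in auto)
    then show ?thesis using class_eq that unfolding f_def by blast
  qed
  let ?B = "(\<lambda>s. R `` {\<pi> s}) ` T"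
  obtain \<phi> where \<phi>: "bij_betw \<phi> (U // R) (U // R)" "\<And>X. X \<in> ?B \<Longrightarrow> \<phi> X = f X"
  proof (rule finite_inj_on_extends_bij)
    show "finite (U // R)" using fin eq by (simp add: finite_quotient equiv_type)
    show "?B \<subseteq> U // R" using U by (auto intro!: quotientI)
    show "f ` ?B \<subseteq> U // R" using U(2) by (auto simp: f intro!: quotientI)
    show "inj_on f ?B" using f class_eq by (auto simp: inj_on_def)
  next
    fix g assume "bij_betw g (U // R) (U // R)" "\<And>X. X \<in> ?B \<Longrightarrow> g X = f X"
    then show thesis by (rule that)
  qed
  let ?\<theta> = "restrict \<pi> T" and ?\<theta>' = "restrict \<pi>' T"
  have PiE: "?\<theta> \<in> T \<rightarrow>\<^sub>E U" "?\<theta>' \<in> T \<rightarrow>\<^sub>E U" using U by auto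
  have "compose T \<phi> (class_map R T ?\<theta>) = class_map R T ?\<theta>'"
    by (rule ext) (simp add: compose_def class_map_def \<phi>(2) f)
  moreover have "compose T \<phi> (class_map R T ?\<theta>) \<in> class_map R T ` \<Theta>"
    using ci \<phi>(1) PiE(1) \<theta> unfolding class_independent_def c by blast
  ultimately have "class_map R T ?\<theta>' \<in> class_map R T ` \<Theta>" by simp
  then have "?\<theta>' \<in> \<Theta>" using ci PiE(2) unfolding class_independent_def c by blast
  then show ?thesis by (simp add: c satisfies_def)
qed

lemma list_less_nthI:
  fixes xs ys :: "'a::linorder list"
  assumes "i < length xs" "i < length ys" "\<And>j. j < i \<Longrightarrow> xs ! j = ys ! j" "xs ! i < ys ! i"
  shows "xs < ys"
  using assms
proof (induction i arbitrary: xs ys)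
  case 0
  then show ?case by (cases xs; cases ys) auto
next
  case (Suc i)
  then obtain x xs' y ys' where xs: "xs = x # xs'" "ys = y # ys'" by (cases xs; cases ys) auto
  have "x = y" using Suc.prems(3)[of 0] xs by simp
  moreover have "xs' < ys'"
    using Suc.prems Suc.prems(3)[of "Suc j" for j] by (intro Suc.IH) (auto simp: xs)
  ultimately show ?case by (simp add: xs)
qed

text \<open>A nonempty list without true entry has the same value as one of equal length whose only
  true entry is the last, hence the premise.\<close>

lemma first_true_bounds:
  assumes "True \<in> set bs"
  shows "1 \<le> first_true bs \<and> first_true bs \<le> length bs \<and> bs ! (first_true bs - 1)"
  using assms
proof (induction bs)
  case (Cons b bs)
  show ?case
  proof (cases b)
    case False
    then have "1 \<le> first_true bs \<and> first_true bs \<le> length bs \<and> bs ! (first_true bs - 1)"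
      using Cons by auto
    then show ?thesis using False by (auto simp: first_true_def nth_Cons split: nat.split)
  qed (simp add: first_true_def)
qed simp

section \<open>Keys of users and their prefixes\<close>

context
  fixes rep :: representation and I :: ncwsp
  assumes inst: "ncwsp_instance rep I"
begin

lemma num_levels_pos: "1 \<le> num_levels I"
  using inst unfolding ncwsp_instance_def Let_def by simp

lemma equiv_levels: "q < num_levels I \<Longrightarrow> equiv {..<num_users I} (levels I ! q)"
  using inst unfolding ncwsp_instance_def Let_def by simp

lemma levels_mono:
  assumes "q \<le> q'" "q' < num_levels I"
  shows "levels I ! q' \<subseteq> levels I ! q"
  using assms
proof (induction rule: dec_induct)
  case (step q')
  have "refinement (levels I ! Suc q') (levels I ! q')"
    using inst step.prems unfolding ncwsp_instance_def Let_def by simp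
  then show ?case using step.IH step.prems unfolding refinement_def by fastforce
qed simp

lemma length_user_key: "length (user_key I u) = Suc (num_levels I)"
  by (simp add: user_key_def level_matrices_def num_levels_def)

lemma user_key_0: "user_key I u ! 0 = 0"
  by (simp add: user_key_def)

lemma user_key_Suc:
  assumes "q < num_levels I" "u < num_users I"
  shows "user_key I u ! Suc q = first_true (map (\<lambda>v. (u, v) \<in> levels I ! q) [0..<num_users I])"
  using assms by (simp add: user_key_def level_matrices_def num_levels_def nth_default_def)

text \<open>By reflexivity the row of a user has a true entry, so each entry of the key that belongs
  to a level, less 1, is a user in the class.\<close>

lemma user_key_Suc_rep:
  assumes "q < num_levels I" "u < num_users I"
  shows "1 \<le> user_key I u ! Suc q" "(u, user_key I u ! Suc q - 1) \<in> levels I ! q"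
proof -
  let ?bs = "map (\<lambda>v. (u, v) \<in> levels I ! q) [0..<num_users I]"
  have "(u, u) \<in> levels I ! q"
    using equiv_levels[OF assms(1)] assms(2) by (auto simp: equiv_def refl_on_def)
  then have "True \<in> set ?bs" using assms(2) by force
  from first_true_bounds[OF this]
  show "1 \<le> user_key I u ! Suc q" "(u, user_key I u ! Suc q - 1) \<in> levels I ! q"
    by (auto simp: user_key_Suc[OF assms])
qed

lemma user_key_eq_iff:
  assumes q: "q < num_levels I" and u: "u < num_users I" and v: "v < num_users I"
  shows "user_key I u ! Suc q = user_key I v ! Suc q \<longleftrightarrow> (u, v) \<in> levels I ! q"
proof
  have eq: "equiv {..<num_users I} (levels I ! q)" by (rule equiv_levels[OF q])
  show "(u, v) \<in> levels I ! q" if "user_key I u ! Suc q = user_key I v ! Suc q"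
    using user_key_Suc_rep(2)[OF q u] user_key_Suc_rep(2)[OF q v] that eq
    by (metis equiv_def symD transD)
  assume "(u, v) \<in> levels I ! q"
  then have "(u, w) \<in> levels I ! q \<longleftrightarrow> (v, w) \<in> levels I ! q" for w
    using eq by (metis equiv_def symD transD)
  then show "user_key I u ! Suc q = user_key I v ! Suc q"
    using q u v by (simp add: user_key_Suc)
qed

text \<open>Settles the default at the end of a key: for \<open>l < num_levels I\<close> the entry
  of \<open>v\<close> at \<open>Suc l\<close> is at least 1 and the second disjunct of
  \<open>key_step\<close> fails, whereas for \<open>l = num_levels I\<close> it reads 0 and the
  disjunct holds.\<close>

lemma key_step_iff:
  assumes "l \<le> num_levels I" "v < num_users I"
  shows "key_step (user_key I u) (user_key I v) l \<longleftrightarrow> user_key I u ! l = user_key I v ! l \<and>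
     (l < num_levels I \<longrightarrow> user_key I u ! Suc l < user_key I v ! Suc l)"
  using assms user_key_Suc_rep(1)[of l v]
  by (auto simp: key_step_def nth_default_def length_user_key)

text \<open>Keeps the leading 0 and the entries of levels 0 to \<open>q\<close>. Thus the prefix
  names the class of \<open>u\<close> at level \<open>q\<close>, and the lexicographic order of
  prefixes is a linear order on these classes.\<close>

definition key_prefix :: "nat \<Rightarrow> nat \<Rightarrow> nat list" where
  "key_prefix q u = take (Suc (Suc q)) (user_key I u)"

text \<open>Levels get finer with their number, so equivalence at level \<open>q\<close> implies it
  at all earlier ones.\<close>

lemma user_key_prefix_eq:
  assumes "q < num_levels I" "u < num_users I" "v < num_users I"
    and "user_key I u ! Suc q = user_key I v ! Suc q" "j \<le> Suc q"
  shows "user_key I u ! j = user_key I v ! j"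
proof (cases j)
  case 0
  then show ?thesis by (simp add: user_key_0)
next
  case (Suc j')
  then have "levels I ! q \<subseteq> levels I ! j'" using assms by (intro levels_mono) auto
  then show ?thesis using assms Suc user_key_eq_iff[of q u v] user_key_eq_iff[of j' u v] by auto
qed

lemma key_prefix_eq_iff:
  assumes "q < num_levels I" "u < num_users I" "v < num_users I"
  shows "key_prefix q u = key_prefix q v \<longleftrightarrow> (u, v) \<in> levels I ! q"
proof -
  have "key_prefix q u = key_prefix q v \<longleftrightarrow> (\<forall>j<Suc (Suc q). user_key I u ! j = user_key I v ! j)"
    using assms(1) by (auto simp: key_prefix_def nth_take_lemma length_user_key list_eq_iff_nth_eq)
  also have "\<dots> \<longleftrightarrow> user_key I u ! Suc q = user_key I v ! Suc q"
    using user_key_prefix_eq[OF assms] by (auto simp: less_Suc_eq_le)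
  finally show ?thesis using user_key_eq_iff[OF assms] by simp
qed

text \<open>For \<open>l < num_levels I\<close> the first difference of the keys is at position
  \<open>Suc l\<close>, which lies in the prefix for \<open>q\<close> exactly if
  \<open>l \<le> q\<close>; for \<open>l = num_levels I\<close> there is none.\<close>

lemma key_step_prefix:
  assumes st: "key_step (user_key I u) (user_key I v) l" and l: "l \<le> num_levels I"
    and u: "u < num_users I" and v: "v < num_users I" and q: "q < num_levels I"
  shows "if q < l then key_prefix q u = key_prefix q v else key_prefix q u < key_prefix q v"
proof -
  have eq: "user_key I u ! j = user_key I v ! j" if "j \<le> l" for j
  proof (cases l)
    case 0
    then show ?thesis using that by (simp add: user_key_0)
  next
    case (Suc l')
    then show ?thesis
      using user_key_prefix_eq[of l' u v j] st l u v that by (simp add: key_step_iff)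
  qed
  show ?thesis
  proof (cases "q < l")
    case True
    then have "user_key I u ! Suc q = user_key I v ! Suc q" by (intro eq) simp
    then show ?thesis using True q u v by (simp add: key_prefix_eq_iff user_key_eq_iff)
  next
    case False
    then have "key_prefix q u ! Suc l < key_prefix q v ! Suc l"
      using st l v q by (simp add: key_step_iff key_prefix_def)
    then have "key_prefix q u < key_prefix q v"
      by (rule list_less_nthI[rotated -1])
        (use False q eq in \<open>auto simp: key_prefix_def length_user_key\<close>)
    then show ?thesis using False by simp
  qed
qed

text \<open>The number stored with the first step has no predecessor to refer to and is left free
  here; \<open>code_plans_complete\<close> fixes it to 0.\<close>

definition key_chain :: "(nat \<times> nat) list \<Rightarrow> nat list \<Rightarrow> bool" where
  "key_chain code us \<longleftrightarrow> length us = length code \<and> set us \<subseteq> {..<num_users I} \<and>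
     (\<forall>i. Suc i < length us \<longrightarrow>
        key_step (user_key I (us ! i)) (user_key I (us ! Suc i)) (snd (code ! Suc i)))"

lemma key_chain_length: "key_chain code us \<Longrightarrow> length us = length code"
  by (simp add: key_chain_def)

lemma key_chain_nth: "key_chain code us \<Longrightarrow> i < length code \<Longrightarrow> us ! i < num_users I"
  unfolding key_chain_def by (metis lessThan_iff nth_mem subsetD)

text \<open>Along a chain the key prefixes increase weakly, so they agree at two positions only if
  they agree everywhere in between.\<close>

lemma key_chain_prefix:
  assumes ch: "key_chain code us" and lev: "snd ` set code \<subseteq> {..num_levels I}"
    and q: "q < num_levels I" and ij: "i \<le> j" "j < length us"
  shows "if \<forall>t. i < t \<and> t \<le> j \<longrightarrow> q < snd (code ! t) then key_prefix q (us ! i) = key_prefix q (us ! j)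
    else key_prefix q (us ! i) < key_prefix q (us ! j)"
  using ij
proof (induction rule: dec_induct)
  case (step j)
  have "snd (code ! Suc j) \<in> snd ` set code"
    using key_chain_length[OF ch] step.prems by auto
  then have "snd (code ! Suc j) \<le> num_levels I" using lev by auto
  moreover have "us ! j < num_users I" "us ! Suc j < num_users I"
    using key_chain_nth[OF ch] key_chain_length[OF ch] step.prems by auto
  ultimately have "if q < snd (code ! Suc j) then key_prefix q (us ! j) = key_prefix q (us ! Suc j)
      else key_prefix q (us ! j) < key_prefix q (us ! Suc j)"
    using ch step.prems q by (intro key_step_prefix) (auto simp: key_chain_def)
  moreover have "(\<forall>t. i < t \<and> t \<le> Suc j \<longrightarrow> q < snd (code ! t)) \<longleftrightarrow>
     (\<forall>t. i < t \<and> t \<le> j \<longrightarrow> q < snd (code ! t)) \<and> q < snd (code ! Suc j)"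
    using step(1) by (auto simp: le_Suc_eq)
  ultimately show ?case using step.IH step.prems by (auto split: if_splits)
qed auto

text \<open>By \<open>key_chain_prefix\<close>, equivalence of two positions is decided by the
  numbers stored between them, and these belong to the code, not to the users.\<close>

lemma key_chain_same_pattern:
  assumes us: "key_chain code us" and vs: "key_chain code vs"
    and lev: "snd ` set code \<subseteq> {..num_levels I}" and q: "q < num_levels I"
    and ij: "i < length code" "j < length code"
  shows "(us ! i, us ! j) \<in> levels I ! q \<longleftrightarrow> (vs ! i, vs ! j) \<in> levels I ! q"
proof -
  note bound = key_chain_nth
  have le: "(us ! i, us ! j) \<in> levels I ! q \<longleftrightarrow> (vs ! i, vs ! j) \<in> levels I ! q"
    if "i \<le> j" "j < length code" for i j
    using key_chain_prefix[OF us lev q that(1)] key_chain_prefix[OF vs lev q that(1)] that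
      us vs bound[OF us] bound[OF vs] q
    by (auto simp: key_chain_def key_prefix_eq_iff[symmetric] split: if_splits)
  have sym: "(x, y) \<in> levels I ! q \<longleftrightarrow> (y, x) \<in> levels I ! q" for x y
    using equiv_levels[OF q] by (meson equiv_def symD)
  show ?thesis
  proof (cases "i \<le> j")
    case False
    then show ?thesis using le[of j i] ij sym by auto
  qed (use le ij in auto)
qed

section \<open>The table of partial plans and chains of users\<close>

lemma auth_matrix_nth:
  assumes "u < num_users I"
  shows "nth_default False (nth_default [] (auth_matrix I) u) s \<longleftrightarrow> s < num_steps I \<and> s \<in> auths I u"
  using assms by (simp add: auth_matrix_def nth_default_def)

text \<open>The table prepends, so a plan lists the steps of the code backwards. The key is tracked
  because it is all that the next extension tests of an entry.\<close>

lemma code_plans_chain: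
  assumes "e \<in> set (code_plans I code)"
  shows "\<exists>us. key_chain code us \<and> snd e = rev (zip (map fst code) us) \<and>
     fst e = (if code = [] then [] else user_key I (last us)) \<and>
     (\<forall>i<length code. fst (code ! i) < num_steps I \<and> fst (code ! i) \<in> auths I (us ! i))"
  using assms
proof (induction code arbitrary: e rule: rev_induct)
  case Nil
  then show ?case by (auto simp: code_plans_def key_chain_def)
next
  case (snoc d code)
  from snoc.prems have "e \<in> set (extend_plans I d (code_plans I code))" by (simp add: code_plans_def)
  then obtain u e' where u: "u < num_users I" and e': "e' \<in> set (code_plans I code)"
    and e: "e = (user_key I u, (fst d, u) # snd e')"
    and st: "key_step (fst e') (user_key I u) (snd d)"
    and au: "nth_default False (nth_default [] (auth_matrix I) u) (fst d)"
    by (rule set_extend_plansE)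
  from snoc.IH[OF e'] obtain us where us: "key_chain code us" "snd e' = rev (zip (map fst code) us)"
    "fst e' = (if code = [] then [] else user_key I (last us))"
    "\<forall>i<length code. fst (code ! i) < num_steps I \<and> fst (code ! i) \<in> auths I (us ! i)" by blast
  have len: "length us = length code" using us(1) by (simp add: key_chain_def)
  have "key_chain (code @ [d]) (us @ [u])"
    unfolding key_chain_def
  proof (intro conjI allI impI)
    fix i assume i: "Suc i < length (us @ [u])"
    show "key_step (user_key I ((us @ [u]) ! i)) (user_key I ((us @ [u]) ! Suc i)) (snd ((code @ [d]) ! Suc i))"
    proof (cases "Suc i < length us")
      case True
      then show ?thesis using us(1) len by (simp add: key_chain_def nth_append)
    next
      case False
      then have "Suc i = length us" using i by simp
      moreover from this have "us ! i = last us" by (metis diff_Suc_1 last_conv_nth length_0_conv nat.distinct(1))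
      ultimately show ?thesis using st us(3) len by (cases "code = []") (auto simp: nth_append)
    qed
  qed (use us(1) u in \<open>auto simp: key_chain_def\<close>)
  moreover have "snd e = rev (zip (map fst (code @ [d])) (us @ [u]))" using us(2) len by (simp add: e)
  moreover have "\<forall>i<length (code @ [d]). fst ((code @ [d]) ! i) < num_steps I \<and>
      fst ((code @ [d]) ! i) \<in> auths I ((us @ [u]) ! i)"
    using us(4) au u len by (auto simp: nth_append less_Suc_eq auth_matrix_nth)
  ultimately show ?case by (intro exI[of _ "us @ [u]"]) (auto simp: e)
qed

text \<open>Only the last key is claimed to survive. The plan found may use other users than
  \<open>us\<close>, since \<open>take 1\<close> may keep a different predecessor; the last key is
  enough for the next step of the induction.\<close>

lemma code_plans_complete:
  assumes "key_chain code us" "code \<noteq> [] \<longrightarrow> snd (hd code) = 0"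
    and "\<forall>i<length code. fst (code ! i) < num_steps I \<and> fst (code ! i) \<in> auths I (us ! i)"
  shows "\<exists>e\<in>set (code_plans I code). fst e = (if code = [] then [] else user_key I (last us))"
  using assms
proof (induction code arbitrary: us rule: rev_induct)
  case Nil
  then show ?case by (simp add: code_plans_def)
next
  case (snoc d code)
  obtain us' u where us: "us = us' @ [u]" and len: "length us' = length code"
    using snoc.prems(1) by (cases us rule: rev_cases) (auto simp: key_chain_def)
  have u: "u < num_users I" using snoc.prems(1) us by (simp add: key_chain_def)
  have "key_chain code us'" unfolding key_chain_def
  proof (intro conjI allI impI)
    fix i assume "Suc i < length us'"
    then show "key_step (user_key I (us' ! i)) (user_key I (us' ! Suc i)) (snd (code ! Suc i))"
      using snoc.prems(1) len unfolding key_chain_def us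
      by (auto simp: nth_append dest!: spec[of _ i])
  qed (use snoc.prems(1) us len in \<open>auto simp: key_chain_def\<close>)
  moreover have "\<forall>i<length code. fst (code ! i) < num_steps I \<and> fst (code ! i) \<in> auths I (us' ! i)"
    using snoc.prems(3) len by (auto simp: us nth_append dest: less_SucI)
  moreover have "code \<noteq> [] \<longrightarrow> snd (hd code) = 0" using snoc.prems(2) by auto
  ultimately obtain e where e: "e \<in> set (code_plans I code)"
    "fst e = (if code = [] then [] else user_key I (last us'))" using snoc.IH by blast
  have "key_step (fst e) (user_key I u) (snd d)"
  proof (cases "code = []")
    case True
    then have "snd d = 0" using snoc.prems(2) by simp
    then show ?thesis
      using e(2) True user_key_Suc_rep(1)[of 0 u] num_levels_pos u
      by (simp add: key_step_def nth_default_def length_user_key user_key_0)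
  next
    case False
    then have ne: "us' \<noteq> []" using len by auto
    obtain i where i: "length code = Suc i" using False by (cases code) auto
    have "\<forall>i. Suc i < length us \<longrightarrow>
        key_step (user_key I (us ! i)) (user_key I (us ! Suc i)) (snd ((code @ [d]) ! Suc i))"
      using snoc.prems(1) by (simp add: key_chain_def)
    then have "key_step (user_key I (us ! i)) (user_key I (us ! Suc i)) (snd ((code @ [d]) ! Suc i))"
      using i len us by simp
    moreover have "us ! i = last us'" using ne len i by (simp add: us nth_append last_conv_nth)
    moreover have "us ! Suc i = u" using i len by (simp add: us nth_append)
    moreover have "(code @ [d]) ! Suc i = d" using i by (simp add: nth_append)
    ultimately show ?thesis using e(2) False by simp
  qed
  then have "filter (\<lambda>e. key_step (fst e) (user_key I u) (snd d)) (code_plans I code) \<noteq> []"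
    using e(1) by (auto simp: filter_empty_conv)
  \<comment> \<open>\<open>e'\<close> need not be \<open>e\<close>; it is whichever fitting
    predecessor comes first.\<close>
  then obtain e' where e': "e' \<in> set (take 1 (filter (\<lambda>e. key_step (fst e) (user_key I u) (snd d)) (code_plans I code)))"
    by (cases "filter (\<lambda>e. key_step (fst e) (user_key I u) (snd d)) (code_plans I code)") auto
  have "nth_default False (nth_default [] (auth_matrix I) u) (fst d)"
    using snoc.prems(3)[rule_format, of "length code"] len u by (simp add: us nth_append auth_matrix_nth)
  then have "(user_key I u, (fst d, u) # snd e') \<in> set (extend_plans I d (code_plans I code))"
    unfolding extend_plans_def set_concat set_map using e' u by force
  then have "(user_key I u, (fst d, u) # snd e') \<in> set (code_plans I (code @ [d]))"
    by (simp add: code_plans_def)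
  then show ?case by (intro bexI[of _ "(user_key I u, (fst d, u) # snd e')"]) (auto simp: us)
qed

section \<open>Accepted codes and valid plans\<close>

definition decoded_plan :: "(nat \<times> nat) list \<Rightarrow> nat \<Rightarrow> nat" where
  "decoded_plan al = (\<lambda>s\<in>{..<num_steps I}. lookup al s)"

lemma accepts_iff:
  "accepts I al \<longleftrightarrow> {..<num_steps I} \<subseteq> fst ` set al \<and> eligible (workflow_of I) (decoded_plan al)"
proof -
  have plan: "(\<lambda>s\<in>{..<num_steps I}. plan_list (num_steps I) al ! s) = decoded_plan al"
    by (auto simp: plan_list_def decoded_plan_def)
  have "list_all (\<lambda>cs. list_all (\<lambda>c. satisfied (num_users I, c, plan_list (num_steps I) al)) cs)
       (coded_constraints I) \<longleftrightarrow>
     (\<forall>cs\<in>set (level_constraints I). \<forall>cd\<in>set cs. satisfies (decoded_plan al) (fst cd))"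
    by (simp add: list_all_iff coded_constraints_def satisfied_def plan split_def)
  also have "\<dots> \<longleftrightarrow> eligible (workflow_of I) (decoded_plan al)"
  proof -
    have "set (level_constraints I) = (\<lambda>q. level_constraints I ! q) ` {..<num_levels I}"
      using length_level_constraints[OF inst] by (force simp: in_set_conv_nth)
    then have "constraints (workflow_of I) = (\<Union>cs\<in>set (level_constraints I). fst ` set cs)"
      by (simp add: workflow_of_def)
    then show ?thesis by (simp add: eligible_def)
  qed
  finally have constr: "list_all (\<lambda>cs. list_all (\<lambda>c. satisfied (num_users I, c, plan_list (num_steps I) al)) cs)
       (coded_constraints I) \<longleftrightarrow> eligible (workflow_of I) (decoded_plan al)" .
  have "list_all (\<lambda>s. list_ex (\<lambda>p. fst p = s) al) [0..<num_steps I] \<longleftrightarrow> {..<num_steps I} \<subseteq> fst ` set al"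
    by (force simp: list_all_iff list_ex_iff)
  then show ?thesis unfolding accepts_def constr by simp
qed

text \<open>The table admits only authorized users, and the constraints are tested on the very plan
  returned. Whichever entry \<open>lookup\<close> picks for a repeated step is authorized.\<close>

lemma accepts_code_sound:
  assumes "accepts_code I code"
  shows "\<exists>\<pi>. valid_plan (workflow_of I) \<pi>"
proof -
  obtain e where e: "e \<in> set (code_plans I code)" and acc: "accepts I (snd e)"
    using assms by (auto simp: accepts_code_def list_ex_iff)
  obtain us where us: "key_chain code us" "snd e = rev (zip (map fst code) us)"
     "\<forall>i<length code. fst (code ! i) < num_steps I \<and> fst (code ! i) \<in> auths I (us ! i)"
    using code_plans_chain[OF e] by blast
  have "lookup (snd e) s < num_users I \<and> s \<in> auths I (lookup (snd e) s)" if "s < num_steps I" for s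
  proof -
    have "(s, lookup (snd e) s) \<in> set (snd e)"
      using acc that by (intro lookup_in) (auto simp: accepts_iff)
    then obtain i where "i < length code" "s = fst (code ! i)" "lookup (snd e) s = us ! i" "i < length us"
      using us(2) by (auto simp: in_set_zip)
    then show ?thesis using us(3) key_chain_nth[OF us(1)] by auto
  qed
  then have "valid_plan (workflow_of I) (decoded_plan (snd e))"
    using acc by (auto simp: accepts_iff valid_plan_def plans_def authorized_def workflow_of_def decoded_plan_def)
  then show ?thesis by blast
qed

text \<open>The cap makes the minimum exist when the keys coincide, that is, for
  \<open>u = v\<close>; the value is then r.\<close>

definition agreement :: "nat \<Rightarrow> nat \<Rightarrow> nat" where
  "agreement u v = (LEAST l. num_levels I \<le> l \<or> user_key I u ! Suc l \<noteq> user_key I v ! Suc l)"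

lemma agreement_le: "agreement u v \<le> num_levels I"
  unfolding agreement_def by (rule Least_le) simp

text \<open>Up to the minimum all entries agree, so the lexicographic order decides the direction of
  the first difference.\<close>

lemma key_step_agreement:
  assumes "user_key I u \<le> user_key I v" "u < num_users I" "v < num_users I"
  shows "key_step (user_key I u) (user_key I v) (agreement u v)"
proof -
  have P: "num_levels I \<le> agreement u v \<or>
      user_key I u ! Suc (agreement u v) \<noteq> user_key I v ! Suc (agreement u v)"
    unfolding agreement_def by (rule LeastI[of _ "num_levels I"]) simp
  have eq: "user_key I u ! j = user_key I v ! j" if "j \<le> agreement u v" for j
  proof (cases j)
    case (Suc j')
    then have "j' < agreement u v" using that by simp
    from not_less_Least[OF this[unfolded agreement_def]] show ?thesis using Suc by simp
  qed (simp add: user_key_0)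
  have "user_key I u ! Suc (agreement u v) < user_key I v ! Suc (agreement u v)"
    if "agreement u v < num_levels I"
  proof (rule ccontr)
    assume "\<not> ?thesis"
    then have "user_key I v ! Suc (agreement u v) < user_key I u ! Suc (agreement u v)"
      using P that by auto
    then have "user_key I v < user_key I u"
      by (rule list_less_nthI[rotated -1]) (use that eq in \<open>auto simp: length_user_key\<close>)
    then show False using assms(1) by simp
  qed
  then show ?thesis using eq[of "agreement u v"] assms agreement_le[of u v]
    by (simp add: key_step_iff)
qed

text \<open>The table yields a plan with the code of \<pi>, in general not \<pi> itself. Both have
  equal patterns on every level, so class-independence carries the constraints over.\<close>

lemma accepts_code_complete:
  assumes valid: "valid_plan (workflow_of I) \<pi>"
  shows "\<exists>code. length code = num_steps I \<and> set code \<subseteq> {..<num_steps I} \<times> {..num_levels I} \<and>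
    accepts_code I code"
proof -
  let ?k = "num_steps I"
  have \<pi>: "\<pi> s < num_users I" "s \<in> auths I (\<pi> s)" if "s < ?k" for s
    using valid that by (auto simp: valid_plan_def plans_def authorized_def workflow_of_def PiE_iff)
  define \<sigma> where "\<sigma> = sort_key (\<lambda>s. user_key I (\<pi> s)) [0..<?k]"
  have \<sigma>: "length \<sigma> = ?k" "set \<sigma> = {..<?k}" "distinct \<sigma>" "sorted (map (\<lambda>s. user_key I (\<pi> s)) \<sigma>)"
    by (auto simp: \<sigma>_def)
  have \<sigma>_lt: "\<sigma> ! i < ?k" if "i < ?k" for i using \<sigma>(1,2) that nth_mem by (metis lessThan_iff)
  define us where "us = map \<pi> \<sigma>"
  \<comment> \<open>The first number is 0 to fit the virtual user with the empty key at the start of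
    the table.\<close>
  define code where
    "code = map (\<lambda>i. (\<sigma> ! i, if i = 0 then 0 else agreement (us ! (i - 1)) (us ! i))) [0..<?k]"
  have len: "length code = ?k" "length us = ?k" by (simp_all add: code_def us_def \<sigma>(1))
  have fst: "map fst code = \<sigma>" by (rule nth_equalityI) (auto simp: code_def \<sigma>(1))
  have lev: "snd ` set code \<subseteq> {..num_levels I}" by (auto simp: code_def agreement_le)
  have chain: "key_chain code us"
    unfolding key_chain_def
  proof (intro conjI allI impI)
    show "set us \<subseteq> {..<num_users I}" using \<pi>(1) \<sigma>(2) by (auto simp: us_def)
    fix i assume i: "Suc i < length us"
    have "user_key I (us ! i) \<le> user_key I (us ! Suc i)"
      using sorted_nth_mono[OF \<sigma>(4), of i "Suc i"] i len \<sigma>(1) by (simp add: us_def)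
    then have "key_step (user_key I (us ! i)) (user_key I (us ! Suc i)) (agreement (us ! i) (us ! Suc i))"
      using i len \<pi>(1) \<sigma>_lt \<sigma>(1) by (intro key_step_agreement) (auto simp: us_def)
    then show "key_step (user_key I (us ! i)) (user_key I (us ! Suc i)) (snd (code ! Suc i))"
      using i len by (simp add: code_def)
  qed (simp add: len)
  have "\<exists>e\<in>set (code_plans I code). fst e = (if code = [] then [] else user_key I (last us))"
  proof (rule code_plans_complete[OF chain])
    show "code \<noteq> [] \<longrightarrow> snd (hd code) = 0" by (auto simp: code_def hd_map)
    show "\<forall>i<length code. fst (code ! i) < ?k \<and> fst (code ! i) \<in> auths I (us ! i)"
      using \<sigma>_lt \<pi>(2) \<sigma>(1) by (simp add: code_def us_def)
  qed
  then obtain e where e: "e \<in> set (code_plans I code)" by blast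
  then obtain vs where vs: "key_chain code vs" "snd e = rev (zip \<sigma> vs)"
    using code_plans_chain[OF e] fst by auto
  have lvs: "length vs = ?k" using vs(1) len by (simp add: key_chain_def)
  have full: "fst ` set (snd e) = {..<?k}"
  proof -
    have "fst ` set (snd e) = set (map fst (zip \<sigma> vs))" by (simp add: vs(2))
    then show ?thesis using \<sigma>(1,2) lvs by simp
  qed
  have look: "lookup (snd e) (\<sigma> ! i) = vs ! i" if "i < ?k" for i
  proof -
    have "(\<sigma> ! i, lookup (snd e) (\<sigma> ! i)) \<in> set (zip \<sigma> vs)"
      using lookup_in[of "\<sigma> ! i" "snd e"] full \<sigma>_lt[OF that] vs(2) by simp
    then obtain j where "j < ?k" "\<sigma> ! j = \<sigma> ! i" "vs ! j = lookup (snd e) (\<sigma> ! i)"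
      using \<sigma>(1) lvs by (auto simp: in_set_zip)
    then show ?thesis using \<sigma>(1,3) that nth_eq_iff_index_eq by metis
  qed
  have "eligible (workflow_of I) (decoded_plan (snd e))"
    unfolding eligible_def
  proof
    fix c assume c: "c \<in> constraints (workflow_of I)"
    then obtain q d where q: "q < num_levels I" and d: "(c, d) \<in> set (level_constraints I ! q)"
      by (auto simp: workflow_of_def)
    show "satisfies (decoded_plan (snd e)) c"
    proof (rule class_independent_same_pattern[OF _ equiv_levels[OF q] constraintsD(3)[OF inst q d]
          constraintsD(1)[OF inst q d], where \<pi> = \<pi>])
      show "satisfies \<pi> c" using valid c by (simp add: valid_plan_def eligible_def)
      show "\<pi> \<in> {..<?k} \<rightarrow> {..<num_users I}" using \<pi>(1) by auto
      have nth: "\<exists>i<?k. s = \<sigma> ! i" if "s < ?k" for s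
        using that \<sigma>(1,2) by (metis in_set_conv_nth lessThan_iff)
      have vs_lt: "vs ! i < num_users I" if "i < ?k" for i
        using key_chain_nth[OF vs(1)] that len by simp
      show "decoded_plan (snd e) \<in> {..<?k} \<rightarrow> {..<num_users I}"
        using nth look vs_lt by (fastforce simp: decoded_plan_def)
      fix s t assume "s \<in> {..<?k}" "t \<in> {..<?k}"
      then obtain i j where ij: "i < ?k" "s = \<sigma> ! i" "j < ?k" "t = \<sigma> ! j" using nth by blast
      show "(\<pi> s, \<pi> t) \<in> levels I ! q \<longleftrightarrow> (decoded_plan (snd e) s, decoded_plan (snd e) t) \<in> levels I ! q"
        using key_chain_same_pattern[OF chain vs(1) lev q, of i j] ij len \<sigma>(1) \<sigma>_lt look
        by (simp add: decoded_plan_def us_def)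
    qed simp
  qed
  then have "accepts_code I code"
    using e full by (auto simp: accepts_code_def list_ex_iff accepts_iff)
  moreover have "set code \<subseteq> {..<?k} \<times> {..num_levels I}"
    using \<sigma>_lt by (auto simp: code_def agreement_le)
  ultimately show ?thesis using len(1) by blast
qed

end

section \<open>Running time\<close>

text \<open>Decrements a list of digit pairs, read as a numeral in mixed radix with its most
  significant digit first; the flag tells whether the numeral was zero and has wrapped around.\<close>

definition prev_code :: "nat \<Rightarrow> nat \<Rightarrow> (nat \<times> nat) list \<Rightarrow> bool \<times> (nat \<times> nat) list" where
  "prev_code B B' code = foldr (\<lambda>d p.
     if fst p
     then if snd d = 0
       then if fst d = 0 then (True, (B, B') # snd p) else (False, (fst d - 1, B') # snd p)
       else (False, (fst d, snd d - 1) # snd p)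
     else (False, d # snd p)) code (True, [])"

text \<open>A pair is one digit in base \<open>Suc B * Suc B'\<close>, itself composed of two
  digits; \<open>B\<close> and \<open>B'\<close> are the largest admissible digits, hence the
  successors.\<close>

fun code_value :: "nat \<Rightarrow> nat \<Rightarrow> (nat \<times> nat) list \<Rightarrow> nat" where
  "code_value B B' [] = 0"
| "code_value B B' (d # ds) =
     (fst d * Suc B' + snd d) * (Suc B * Suc B') ^ length ds + code_value B B' ds"

lemma digit_less:
  assumes "d \<in> {..B} \<times> {..B'}"
  shows "fst d * Suc B' + snd d < Suc B * Suc B'"
proof -
  have "fst d * Suc B' + snd d \<le> B * Suc B' + B'"
    using assms by (intro add_mono mult_right_mono) auto
  then show ?thesis by simp
qed

lemma code_value_less:
  assumes "set ds \<subseteq> {..B} \<times> {..B'}"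
  shows "code_value B B' ds < (Suc B * Suc B') ^ length ds"
  using assms
proof (induction ds)
  case (Cons d ds)
  define M v where "M = Suc B * Suc B'" and "v = fst d * Suc B' + snd d"
  have "code_value B B' (d # ds) < v * M ^ length ds + M ^ length ds"
    using Cons by (simp add: M_def v_def)
  also have "\<dots> = Suc v * M ^ length ds" by simp
  also have "\<dots> \<le> M * M ^ length ds"
    using digit_less[of d B B'] Cons.prems by (intro mult_right_mono) (auto simp: M_def v_def)
  finally show ?case by (simp only: M_def list.size power_Suc add_0_right add_Suc_right)
qed simp

lemma divmod_unique_nat:
  fixes a b a' b' m :: nat
  assumes "a * m + b = a' * m + b'" "b < m" "b' < m"
  shows "a = a' \<and> b = b'"
proof -
  have "a = (a * m + b) div m" using assms(2) by simp
  also have "\<dots> = (a' * m + b') div m" by (simp only: assms(1))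
  also have "\<dots> = a'" using assms(3) by simp
  finally show ?thesis using assms(1) by simp
qed

lemma code_value_inject:
  assumes "set ds \<subseteq> {..B} \<times> {..B'}" "set es \<subseteq> {..B} \<times> {..B'}" "length ds = length es"
    and "code_value B B' ds = code_value B B' es"
  shows "ds = es"
  using assms(3,1,2,4)
proof (induction ds es rule: list_induct2)
  case (Cons d ds e es)
  have len: "length es = length ds" using Cons.hyps by simp
  have "fst d * Suc B' + snd d = fst e * Suc B' + snd e \<and> code_value B B' ds = code_value B B' es"
    using Cons.prems code_value_less[of ds B B'] code_value_less[of es B B']
    by (intro divmod_unique_nat[where m = "(Suc B * Suc B') ^ length ds"])
      (auto simp only: code_value.simps len set_simps insert_subset)
  moreover from this have "fst d = fst e \<and> snd d = snd e"
    using Cons.prems by (intro divmod_unique_nat[where m = "Suc B'"]) auto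
  ultimately show ?case using Cons by (simp add: prod_eq_iff)
qed simp

lemma prev_code_correct:
  assumes "set ds \<subseteq> {..B} \<times> {..B'}"
  shows "length (snd (prev_code B B' ds)) = length ds \<and>
    set (snd (prev_code B B' ds)) \<subseteq> {..B} \<times> {..B'} \<and>
    (fst (prev_code B B' ds) \<longleftrightarrow> code_value B B' ds = 0) \<and>
    code_value B B' (snd (prev_code B B' ds)) =
      (if code_value B B' ds = 0 then (Suc B * Suc B') ^ length ds - 1 else code_value B B' ds - 1)"
  using assms
proof (induction ds)
  case Nil
  then show ?case by (simp add: prev_code_def)
next
  case (Cons d ds)
  let ?p = "prev_code B B' ds" and ?M = "Suc B * Suc B'"
  define P where "P = ?M ^ length ds"
  have P: "P > 0" by (simp add: P_def)
  have IH: "length (snd ?p) = length ds" "set (snd ?p) \<subseteq> {..B} \<times> {..B'}"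
    "fst ?p \<longleftrightarrow> code_value B B' ds = 0"
    "code_value B B' (snd ?p) = (if code_value B B' ds = 0 then P - 1 else code_value B B' ds - 1)"
    using Cons by (auto simp: P_def)
  obtain x y where d: "d = (x, y)" by (cases d)
  have xy: "x \<le> B" "y \<le> B'" using Cons.prems d by auto
  have step: "prev_code B B' (d # ds) = (if fst ?p
     then if y = 0
       then if x = 0 then (True, (B, B') # snd ?p) else (False, (x - 1, B') # snd ?p)
       else (False, (x, y - 1) # snd ?p)
     else (False, d # snd ?p))" by (simp add: prev_code_def d)
  have val: "code_value B B' ((x', y') # snd ?p) = (x' * Suc B' + y') * P + code_value B B' (snd ?p)" for x' y'
    by (simp add: IH(1) P_def)
  have val_d: "code_value B B' (d # ds) = (x * Suc B' + y) * P + code_value B B' ds"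
    by (simp add: P_def d)
  \<comment> \<open>A wrapped tail consists of maximal digits and has value \<open>P - 1\<close>, so
    together with a leading digit lowered by 1 it amounts to a decrement of the whole.\<close>
  have borrow: "v * P + (P - 1) = Suc v * P - 1" for v using P by (simp add: algebra_simps)
  show ?case
  proof (cases "fst ?p")
    case False
    then show ?thesis using step IH xy P val[of x y] val_d by (simp add: d)
  next
    case True
    then have 0: "code_value B B' ds = 0" "code_value B B' (snd ?p) = P - 1" using IH by auto
    consider "y \<noteq> 0" | "y = 0" "x \<noteq> 0" | "y = 0" "x = 0" by blast
    then show ?thesis
    proof cases
      case 1
      then have "x * Suc B' + y = Suc (x * Suc B' + (y - 1))" by simp
      then have "code_value B B' ((x, y - 1) # snd ?p) = code_value B B' (d # ds) - 1"
        "code_value B B' (d # ds) \<noteq> 0"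
        using P by (simp_all only: val val_d 0 borrow) auto
      then show ?thesis using 1 True step IH xy by auto
    next
      case 2
      then have "x * Suc B' + y = Suc ((x - 1) * Suc B' + B')" by (cases x) auto
      then have "code_value B B' ((x - 1, B') # snd ?p) = code_value B B' (d # ds) - 1"
        "code_value B B' (d # ds) \<noteq> 0"
        using P by (simp_all only: val val_d 0 borrow) auto
      then show ?thesis using 2 True step IH xy by auto
    next
      case 3
      have "Suc (B * Suc B' + B') * P = ?M ^ length (d # ds)" by (simp add: P_def)
      then have "code_value B B' ((B, B') # snd ?p) = ?M ^ length (d # ds) - 1"
        by (simp only: val 0 borrow)
      moreover have "code_value B B' (d # ds) = 0" using 3 0 val_d by simp
      ultimately show ?thesis using 3 True step IH xy by auto
    qed
  qed
qed

text \<open>Counting down from the largest numeral makes the flag of \<open>prev_code\<close> the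
  stopping test of the loop. A unary counter of the rounds could be exponentially long.\<close>

definition nth_code :: "nat \<Rightarrow> nat \<Rightarrow> nat \<Rightarrow> nat \<Rightarrow> (nat \<times> nat) list" where
  "nth_code B B' k i = ((\<lambda>ds. snd (prev_code B B' ds)) ^^ i) (replicate k (B, B'))"

lemma code_value_replicate: "code_value B B' (replicate k (B, B')) = (Suc B * Suc B') ^ k - 1"
proof (induction k)
  case (Suc k)
  let ?P = "(Suc B * Suc B') ^ k"
  have "?P > 0" by simp
  then have "(B * Suc B' + B') * ?P + (?P - 1) = Suc (B * Suc B' + B') * ?P - 1"
    by (simp only: mult_Suc)
  also have "Suc (B * Suc B' + B') = Suc B * Suc B'" by simp
  finally show ?case using Suc by (simp del: mult_Suc mult_Suc_right)
qed simp

lemma nth_code_correct: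
  assumes "i < (Suc B * Suc B') ^ k"
  shows "length (nth_code B B' k i) = k \<and> set (nth_code B B' k i) \<subseteq> {..B} \<times> {..B'} \<and>
    code_value B B' (nth_code B B' k i) = (Suc B * Suc B') ^ k - 1 - i"
  using assms
proof (induction i)
  case 0
  then show ?case using code_value_replicate[of B B' k] by (auto simp: nth_code_def)
next
  case (Suc i)
  then show ?case using prev_code_correct[of "nth_code B B' k i" B B'] by (simp add: nth_code_def)
qed

lemma nth_code_surj:
  assumes "length ds = k" "set ds \<subseteq> {..B} \<times> {..B'}"
  shows "\<exists>i < (Suc B * Suc B') ^ k. nth_code B B' k i = ds"
proof -
  let ?N = "(Suc B * Suc B') ^ k" and ?i = "(Suc B * Suc B') ^ k - 1 - code_value B B' ds"
  have "code_value B B' ds < ?N" using code_value_less[OF assms(2)] assms(1) by simp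
  then have i: "?i < ?N" "?N - 1 - ?i = code_value B B' ds" by linarith+
  have "nth_code B B' k ?i = ds"
    using nth_code_correct[OF i(1)] assms i(2) by (intro code_value_inject[where B = B and B' = B']) auto
  then show ?thesis using i(1) by blast
qed

lemma computes_prev_code [computes_intros]:
  assumes f: "computes b D eA f enc_nat" and g: "computes b D eA g enc_nat"
    and h: "computes b D eA h enc_code"
  shows "computes b D eA (\<lambda>a. prev_code (f a) (g a) (h a)) (enc_prod enc_bool enc_code)"
proof -
  let ?enc = "enc_prod enc_nat (enc_prod enc_nat enc_code)"
  have shape: "length (snd (prev_code B B' ds)) = length ds \<and>
      (\<forall>d\<in>set (snd (prev_code B B' ds)). fst d \<le> A \<and> snd d \<le> A)"
    if "B \<le> A" "B' \<le> A" "\<forall>d\<in>set ds. fst d \<le> A \<and> snd d \<le> A" for B B' A ds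
    using that by (induction ds) (auto simp: prev_code_def)
  let ?q = "\<lambda>A. 2 + A * Suc (2 * A + 1)"
  have "computes b UNIV ?enc (\<lambda>a. prev_code (fst a) (fst (snd a)) (snd (snd a))) (enc_prod enc_bool enc_code)"
    unfolding prev_code_def
  proof (rule computes_foldr[where E = UNIV and q = ?q])
    fix a :: "nat \<times> nat \<times> (nat \<times> nat) list" and ys zs
    obtain B B' ds where a: "a = (B, B', ds)" by (metis prod.collapse)
    assume "snd (snd a) = ys @ zs"
    then have ds: "ds = ys @ zs" by (simp add: a)
    let ?A = "size (?enc a)" and ?r = "prev_code B B' zs"
    have code: "size (enc_code ds) \<le> ?A" by (simp add: a enc_prod_def)
    have "fst d \<le> ?A \<and> snd d \<le> ?A" if "d \<in> set zs" for d
      using size_le_size_enc_list[of d ds "enc_prod enc_nat enc_nat"] that code ds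
      by (simp add: enc_prod_def)
    moreover have "B \<le> ?A" "B' \<le> ?A" by (simp_all add: a enc_prod_def)
    ultimately have r: "length (snd ?r) = length zs" "\<forall>d\<in>set (snd ?r). fst d \<le> ?A \<and> snd d \<le> ?A"
      using shape[of B ?A B' zs] by blast+
    have "size (enc_code (snd ?r)) \<le> length (snd ?r) * Suc (2 * ?A + 1)"
      by (rule size_enc_list_le) (use r(2) in \<open>fastforce simp: enc_prod_def\<close>)
    also have "length (snd ?r) \<le> ?A"
      using r(1) length_le_size_enc_list[of ds "enc_prod enc_nat enc_nat"] code ds by simp
    then have "length (snd ?r) * Suc (2 * ?A + 1) \<le> ?A * Suc (2 * ?A + 1)" by (rule mult_right_mono) simp
    finally have "size (enc_prod enc_bool enc_code ?r) \<le> ?q ?A"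
      using size_enc_bool[of "fst ?r"] by (simp add: enc_prod_def[of enc_bool])
    then show "size (enc_prod enc_bool enc_code (foldr (\<lambda>d p.
       if fst p
       then if snd d = 0
         then if fst d = 0 then (True, (fst a, fst (snd a)) # snd p) else (False, (fst d - 1, fst (snd a)) # snd p)
         else (False, (fst d, snd d - 1) # snd p)
       else (False, d # snd p)) zs (True, []))) \<le> ?q ?A"
      by (simp only: prev_code_def a fst_conv snd_conv)
  qed (rule computes_intros poly_bounded_intros | simp del: mult_Suc mult_Suc_right)+
  from computes_comp[OF computes_pair[OF f computes_pair[OF g h]] this] show ?thesis by simp
qed

text \<open>Uses \<open>clean_run\<close> directly because the number of rounds may be exponential,
  out of reach of \<open>computes\<close> with enforced time. A test of the guard costs 4 and is
  made \<open>N + 1\<close> times.\<close>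

lemma clean_run_while:
  assumes "\<And>i. i < N \<Longrightarrow> clean_run True K c (v i) (v (Suc i)) M"
    and "\<And>i. i \<le> N \<Longrightarrow> vhd (vhd (v i)) \<noteq> Atom \<longleftrightarrow> i < N"
  shows "clean_run True K (While (EHd (EHd (EVar 0))) c) (v 0) (v N) (N * (M + 4) + 4)"
  using assms
proof (induction N arbitrary: v)
  case 0
  show ?case unfolding clean_run_def
  proof (intro allI impI)
    fix s :: state assume s: "s 0 = v 0"
    then have "exec (While (EHd (EHd (EVar 0))) c) s (exp_cost (EHd (EHd (EVar 0))) + 1) s"
      using 0(2)[of 0] by (intro exec.WhileFalse) simp
    moreover have "s(0 := v 0) = s" using s by auto
    ultimately show "\<exists>m. exec (While (EHd (EHd (EVar 0))) c) s m (s(0 := v 0)) \<and>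
        (True \<longrightarrow> m \<le> 0 * (M + 4) + 4)" by (intro exI[of _ 4]) (simp add: eval_nat_numeral)
  qed
next
  case (Suc N)
  have IH: "clean_run True K (While (EHd (EHd (EVar 0))) c) (v (Suc 0)) (v (Suc N)) (N * (M + 4) + 4)"
    using Suc.IH[of "\<lambda>i. v (Suc i)"] Suc.prems by simp
  show ?case unfolding clean_run_def
  proof (intro allI impI)
    fix s :: state assume s: "s 0 = v 0" "\<forall>x. 0 < x \<and> x < K \<longrightarrow> s x = Atom"
    obtain m where m: "exec c s m (s(0 := v (Suc 0)))" "m \<le> M"
      using clean_runD[OF Suc.prems(1)[of 0], of s] s by auto
    obtain m' where m': "exec (While (EHd (EHd (EVar 0))) c) (s(0 := v (Suc 0))) m' (s(0 := v (Suc N)))"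
      "m' \<le> N * (M + 4) + 4"
      using clean_runD[OF IH, of "s(0 := v (Suc 0))"] s by auto
    have "eval_exp (EHd (EHd (EVar 0))) s \<noteq> Atom" using Suc.prems(2)[of 0] s(1) by simp
    from exec.WhileTrue[OF this m(1) m'(1)]
    have "exec (While (EHd (EHd (EVar 0))) c) s (4 + m + m') (s(0 := v (Suc N)))"
      by (simp add: eval_nat_numeral)
    then show "\<exists>m. exec (While (EHd (EHd (EVar 0))) c) s m (s(0 := v (Suc N))) \<and>
        (True \<longrightarrow> m \<le> Suc N * (M + 4) + 4)"
      using m(2) m'(2) by (intro exI[of _ "4 + m + m'"]) auto
  qed
qed

section \<open>States of the search\<close>

text \<open>The components of a search state are: codes are left, an accepted code was found, the
  current code.\<close>

type_synonym search_state = "bool \<times> bool \<times> (nat \<times> nat) list"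

text \<open>Written with projections instead of patterns, so that the rules for
  \<open>computes\<close> apply to it literally.\<close>

definition search_step :: "search_state \<times> ncwsp \<Rightarrow> search_state \<times> ncwsp" where
  "search_step p =
     ((\<not> fst (prev_code (num_steps (snd p) - 1) (num_levels (snd p)) (snd (snd (fst p)))),
       fst (snd (fst p)) \<or> accepts_code (snd p) (snd (snd (fst p))),
       snd (prev_code (num_steps (snd p) - 1) (num_levels (snd p)) (snd (snd (fst p))))), snd p)"

abbreviation enc_search :: "search_state \<times> ncwsp \<Rightarrow> val" where
  "enc_search \<equiv> enc_prod (enc_prod enc_bool (enc_prod enc_bool enc_code)) enc_ncwsp"

lemma computes_search_step:
  assumes "poly_time_checkable rep"
  shows "computes True {p. ncwsp_instance rep (snd p)} enc_search search_step enc_search"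
proof -
  have 1: "computes True {p \<in> {p. ncwsp_instance rep (snd p)}. \<not> fst (snd (fst p))} enc_search
     (\<lambda>p :: search_state \<times> ncwsp. (snd (snd (fst p)), snd p)) (enc_prod enc_code enc_ncwsp)"
    by (rule computes_intros)+
  have "computes True {p \<in> {p. ncwsp_instance rep (snd p)}. \<not> fst (snd (fst p))} enc_search
     (\<lambda>p :: search_state \<times> ncwsp. accepts_code (snd p) (snd (snd (fst p)))) enc_bool"
    using computes_comp[OF 1 computes_accepts_code[OF assms]] by simp
  note acc = this
  show ?thesis unfolding search_step_def[abs_def]
    by (rule computes_pair computes_disj acc computes_not computes_fst computes_snd computes_id
        computes_prev_code computes_minus computes_num_steps computes_num_levels computes_const)+
qed

definition num_codes :: "ncwsp \<Rightarrow> nat" where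
  "num_codes I = ((num_levels I + 1) * num_steps I) ^ num_steps I"

text \<open>\<open>nth_code\<close> takes the largest digits, so its base for steps is
  \<open>Suc (num_steps I - 1)\<close>. This is the number of steps unless that is 0, and then both
  powers have exponent 0.\<close>

lemma num_codes_eq: "num_codes I = (Suc (num_steps I - 1) * Suc (num_levels I)) ^ num_steps I"
  by (cases "num_steps I") (auto simp: num_codes_def mult.commute)

lemma num_codes_pos: "1 \<le> num_codes I"
  unfolding num_codes_eq by (simp add: Suc_le_eq)

definition search_state :: "ncwsp \<Rightarrow> nat \<Rightarrow> search_state \<times> ncwsp" where
  "search_state I i =
     ((i < num_codes I, (\<exists>j<i. accepts_code I (nth_code (num_steps I - 1) (num_levels I) (num_steps I) j)),
       nth_code (num_steps I - 1) (num_levels I) (num_steps I) i), I)"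

text \<open>The decrement wraps exactly at value 0, that is, in the last round.\<close>

lemma search_step_state:
  assumes "i < num_codes I"
  shows "search_step (search_state I i) = search_state I (Suc i)"
proof -
  let ?c = "nth_code (num_steps I - 1) (num_levels I) (num_steps I)"
  have nc: "set (?c i) \<subseteq> {..num_steps I - 1} \<times> {..num_levels I}"
    "code_value (num_steps I - 1) (num_levels I) (?c i) = num_codes I - 1 - i"
    using nth_code_correct[of i "num_steps I - 1" "num_levels I" "num_steps I"] assms
    unfolding num_codes_eq by blast+
  have "fst (prev_code (num_steps I - 1) (num_levels I) (?c i)) \<longleftrightarrow> num_codes I - 1 - i = 0"
    using prev_code_correct[OF nc(1)] nc(2) by simp
  moreover have "snd (prev_code (num_steps I - 1) (num_levels I) (?c i)) = ?c (Suc i)"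
    by (simp add: nth_code_def)
  ultimately show ?thesis
    using assms by (auto simp: search_step_def search_state_def less_Suc_eq)
qed

lemma search_result:
  assumes inst: "ncwsp_instance rep I"
  shows "fst (snd (fst (search_state I (num_codes I)))) \<longleftrightarrow> (\<exists>\<pi>. valid_plan (workflow_of I) \<pi>)"
proof -
  let ?c = "nth_code (num_steps I - 1) (num_levels I) (num_steps I)"
  have "(\<exists>j<num_codes I. accepts_code I (?c j)) \<longleftrightarrow> (\<exists>\<pi>. valid_plan (workflow_of I) \<pi>)"
  proof
    assume "\<exists>\<pi>. valid_plan (workflow_of I) \<pi>"
    then obtain code where code: "length code = num_steps I"
      "set code \<subseteq> {..<num_steps I} \<times> {..num_levels I}" "accepts_code I code"
      using accepts_code_complete[OF inst] by blast
    have "set code \<subseteq> {..num_steps I - 1} \<times> {..num_levels I}" using code(2) by auto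
    from nth_code_surj[OF code(1) this] show "\<exists>j<num_codes I. accepts_code I (?c j)"
      using code(3) unfolding num_codes_eq by blast
  qed (use accepts_code_sound[OF inst] in blast)
  then show ?thesis by (simp add: search_state_def)
qed

text \<open>The state stays small throughout the enumeration, which turns the polynomial time of one
  round into a single bound for all rounds.\<close>

lemma size_search_state:
  assumes "i \<le> num_codes I"
  shows "size (enc_search (search_state I i)) \<le>
    (let A = size (enc_ncwsp I) in A * Suc (2 * A + 1) + A + 5)"
proof -
  let ?A = "size (enc_ncwsp I)"
  let ?c = "nth_code (num_steps I - 1) (num_levels I) (num_steps I)"
  have k: "num_steps I \<le> ?A" by (simp add: enc_ncwsp_eq enc_prod_def)
  have "num_levels I \<le> size (enc_list (enc_list (enc_list enc_bool)) (level_matrices I))"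
    using length_le_size_enc_list[of "level_matrices I" "enc_list (enc_list enc_bool)"]
    by (simp add: level_matrices_def num_levels_def)
  then have r: "num_levels I \<le> ?A" by (simp add: enc_ncwsp_eq enc_prod_def)
  \<comment> \<open>At \<open>i = num_codes I\<close> the counter has wrapped around, which
    \<open>nth_code_correct\<close> does not cover; the shape is then taken from the previous
    code.\<close>
  have c: "length (?c i) = num_steps I \<and> set (?c i) \<subseteq> {..num_steps I - 1} \<times> {..num_levels I}"
  proof (cases i)
    case 0
    then show ?thesis by (auto simp: nth_code_def)
  next
    case (Suc j)
    then have "j < (Suc (num_steps I - 1) * Suc (num_levels I)) ^ num_steps I"
      using assms by (simp add: num_codes_eq)
    from nth_code_correct[OF this] show ?thesis
      using prev_code_correct[of "?c j"] by (simp add: nth_code_def Suc)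
  qed
  have "size (enc_code (?c i)) \<le> length (?c i) * Suc (2 * ?A + 1)"
  proof (rule size_enc_list_le)
    fix d assume "d \<in> set (?c i)"
    then have "fst d \<le> num_steps I - 1" "snd d \<le> num_levels I" using c by auto
    then show "size (enc_prod enc_nat enc_nat d) \<le> 2 * ?A + 1" using k r by (simp add: enc_prod_def)
  qed
  also have "\<dots> \<le> ?A * Suc (2 * ?A + 1)" by (rule mult_right_mono) (use c k in auto)
  finally show ?thesis
    using size_enc_bool[of "i < num_codes I"] size_enc_bool[of "\<exists>j<i. accepts_code I (?c j)"]
    by (simp add: search_state_def enc_prod_def[of "enc_prod enc_bool (enc_prod enc_bool enc_code)"]
        enc_prod_def[of enc_bool] Let_def)
qed

section \<open>Total running time\<close>

lemma nested_ci_wsp_solvable: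
  assumes rep: "poly_time_checkable rep"
  shows "solvable_in_O_star (nested_ci_wsp rep) (\<lambda>I. real (num_codes I))"
proof -
  have "computes True {I. ncwsp_instance rep I} enc_ncwsp
     (\<lambda>I. ((True, False, replicate (num_steps I) (num_steps I - 1, num_levels I)), I)) enc_search"
    by (rule computes_replicate computes_intros)+
  moreover have "((True, False, replicate (num_steps I) (num_steps I - 1, num_levels I)), I) = search_state I 0" for I
    using num_codes_pos[of I] by (simp add: search_state_def nth_code_def)
  ultimately have "computes True {I. ncwsp_instance rep I} enc_ncwsp (\<lambda>I. search_state I 0) enc_search"
    by simp
  then obtain K0 c0 p0 where init: "\<And>I K. ncwsp_instance rep I \<Longrightarrow> K0 \<le> K \<Longrightarrow>
      clean_run True K c0 (enc_ncwsp I) (enc_search (search_state I 0)) (poly p0 (size (enc_ncwsp I)))"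
    by (rule computesE) auto
  obtain K1 c1 p1 where step: "\<And>p K. ncwsp_instance rep (snd p) \<Longrightarrow> K1 \<le> K \<Longrightarrow>
      clean_run True K c1 (enc_search p) (enc_search (search_step p)) (poly p1 (size (enc_search p)))"
    by (rule computesE[OF computes_search_step[OF rep]]) auto
  let ?K = "max K0 K1"
  let ?result = "EHd (ETl (EHd (EVar 0)))"
  let ?prog = "Seq c0 (Seq (While (EHd (EHd (EVar 0))) c1) (Assign 0 ?result))"
  let ?M = "\<lambda>A. poly p1 (A * Suc (2 * A + 1) + A + 5)"
  \<comment> \<open>13 collects 4 for a test of the loop in each round, 4 for the last test and 5
    for reading the result.\<close>
  have "poly_bounded (\<lambda>A. poly p0 A + ?M A + 13)" by (intro poly_bounded_intros)
  then obtain p where p: "\<And>A. poly p0 A + ?M A + 13 \<le> poly p A" unfolding poly_bounded_def by blast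
  have "\<exists>m. runs ?prog (enc_ncwsp I) (enc_bool (\<exists>\<pi>. valid_plan (workflow_of I) \<pi>)) m \<and>
      m \<le> num_codes I * poly p (size (enc_ncwsp I))"
    if inst: "ncwsp_instance rep I" for I
  proof -
    let ?A = "size (enc_ncwsp I)" and ?N = "num_codes I"
    have loop: "clean_run True ?K (While (EHd (EHd (EVar 0))) c1) (enc_search (search_state I 0))
        (enc_search (search_state I ?N)) (?N * (?M ?A + 4) + 4)"
    proof (rule clean_run_while)
      fix i assume i: "i < ?N"
      have "poly p1 (size (enc_search (search_state I i))) \<le> ?M ?A"
        using size_search_state[of i I] i by (intro poly_nat_mono) (simp add: Let_def)
      moreover have "clean_run True ?K c1 (enc_search (search_state I i)) (enc_search (search_state I (Suc i)))
          (poly p1 (size (enc_search (search_state I i))))"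
        using step[of "search_state I i" ?K] inst search_step_state[OF i] by (simp add: search_state_def)
      ultimately show "clean_run True ?K c1 (enc_search (search_state I i))
          (enc_search (search_state I (Suc i))) (?M ?A)" by (elim clean_run_mono) auto
    next
      fix i
      show "vhd (vhd (enc_search (search_state I i))) \<noteq> Atom \<longleftrightarrow> i < ?N"
        by (simp add: search_state_def enc_prod_def enc_bool_eq_Atom)
    qed
    have out: "clean_run True ?K (Assign 0 ?result) (enc_search (search_state I ?N))
        (enc_bool (\<exists>\<pi>. valid_plan (workflow_of I) \<pi>)) 5"
      using clean_run_Assign[of ?result True ?K "enc_search (search_state I ?N)"]
        search_result[OF inst] by (simp add: enc_prod_def eval_nat_numeral)
    have "clean_run True ?K ?prog (enc_ncwsp I) (enc_bool (\<exists>\<pi>. valid_plan (workflow_of I) \<pi>))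
        (poly p0 ?A + (?N * (?M ?A + 4) + 4 + 5))"
      by (rule clean_run_Seq[OF init[OF inst] clean_run_Seq[OF loop out]]) simp
    from clean_run_runs[OF this] obtain m where
      m: "runs ?prog (enc_ncwsp I) (enc_bool (\<exists>\<pi>. valid_plan (workflow_of I) \<pi>)) m"
        "m \<le> poly p0 ?A + (?N * (?M ?A + 4) + 4 + 5)" by auto
    \<comment> \<open>There is at least one code, so the costs outside the loop are absorbed into
      the factor \<open>?N\<close>.\<close>
    have "poly p0 ?A + 9 \<le> ?N * (poly p0 ?A + 9)" using num_codes_pos[of I] by simp
    then have "m \<le> ?N * (poly p0 ?A + ?M ?A + 13)"
      using m(2) by (simp only: distrib_left)
    also have "\<dots> \<le> ?N * poly p ?A" by (rule mult_left_mono[OF p]) simp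
    finally show ?thesis using m(1) by blast
  qed
  then have "decides_in_time ?prog (nested_ci_wsp rep)
      (\<lambda>I. real (num_codes I) * real (poly p (size (encode (nested_ci_wsp rep) I))))"
    unfolding decides_in_time_def nested_ci_wsp_def
    by (simp flip: of_nat_mult)
  then show ?thesis unfolding solvable_in_O_star_def by blast
qed

text \<open>With no steps the exponent is 0 whatever \<open>log 2 0\<close> is, and both sides are
  1.\<close>

lemma real_num_codes:
  "real (num_codes I) =
    2 powr (real (num_steps I) * log 2 ((real (num_levels I) + 1) * real (num_steps I)))"
proof (cases "num_steps I = 0")
  case False
  let ?x = "(real (num_levels I) + 1) * real (num_steps I)"
  have "?x > 0" using False by simp
  then have "2 powr (real (num_steps I) * log 2 ?x) = ?x ^ num_steps I"
    by (simp add: powr_powr[symmetric] mult.commute[of "real (num_steps I)"] powr_realpow)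
  moreover have "real (num_codes I) = ?x ^ num_steps I" by (simp add: num_codes_def algebra_simps)
  ultimately show ?thesis by simp
qed (simp add: num_codes_def)

theorem theorem3:
  fixes rep :: representation
  assumes "poly_time_checkable rep"
  shows "fixed_parameter_tractable (nested_ci_wsp rep) num_steps num_levels \<and>
    solvable_in_O_star (nested_ci_wsp rep)
      (\<lambda>I. 2 powr (real (num_steps I) * log 2 ((real (num_levels I) + 1) * real (num_steps I))))"
proof
  note solvable = nested_ci_wsp_solvable[OF assms]
  \<comment> \<open>Tractability asks that the parameter function be computable, with no bound on
    time, hence \<open>b = False\<close> in \<open>computable2I\<close>.\<close>
  have "computable2 (\<lambda>k r. (Suc r * k) ^ k)"
    by (rule computable2I)
      (rule computable_power computable_mult computes_Suc computes_fst computes_snd computes_id)+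
  then show "fixed_parameter_tractable (nested_ci_wsp rep) num_steps num_levels"
    using solvable unfolding fixed_parameter_tractable_def num_codes_def by auto
  show "solvable_in_O_star (nested_ci_wsp rep)
      (\<lambda>I. 2 powr (real (num_steps I) * log 2 ((real (num_levels I) + 1) * real (num_steps I))))"
    using solvable by (simp only: real_num_codes)
qed

end
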